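(* Let $n\in\mathbb{N}$, let $\mu$ be the standard Gaussian measure on $\mathbb{R}^n$, let $\nu_1$ and $\nu_2$ be two probability measures on $(\mathbb{R}^n,\mathcal{B}(\mathbb{R}^n))$ and define, for $w\in\mathbb{R}^n$, $$\xi_i(w):=\int_{\mathbb{R}^n}\exp\Big\{\langle w,y\rangle-\frac{|y|^2}{2}\Big\}\,d\nu_i(y),\quad i=1,2.$$ Assume that for some $p>2$ the integrals $$\int_{\mathbb{R}^n}\exp\Big\{(p-1)\frac{|y|^2}{2}\Big\}\,d\nu_i(y),\quad i=1,2,$$ are finite. Then $$\xi_1\cdot\xi_2\geq \xi_1\diamond\xi_2+\sum_{k=1}^n\partial_{x_k}\xi_1\diamond\partial_{x_k}\xi_2\quad\text{in }\mathcal{G}^*,$$ i.e., for any non-negative $\varphi\in\mathcal{G}$ one has $$\langle\langle\xi_1\cdot\xi_2,\varphi\rangle\rangle-\langle\langle\xi_1\diamond\xi_2,\varphi\rangle\rangle-\sum_{k=1}^n\langle\langle\partial_{x_k}\xi_1\diamond\partial_{x_k}\xi_2,\varphi\rangle\rangle\geq 0.$$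
   Context: $\mu(A)=\int_A(2\pi)^{-n/2}e^{-|w|^2/2}dw$, with $|\cdot|$ the Euclidean norm and $\langle\cdot,\cdot\rangle$ the Euclidean inner product; this is the abstract Wiener space $W=H=\mathbb{R}^n$. Each $f\in\mathcal{L}^2(\mathbb{R}^n,\mu)$ has a unique orthogonal chaos (Hermite) expansion $f=\sum_{m\ge0}\delta^m(f_m)$ with $f_m$ in the symmetric tensor power $H^{\hat\otimes m}$ and $\delta^m$ the $m$-fold multiple Wiener-Itô integral, with $\Vert f\Vert_2^2=\sum_m m!\Vert f_m\Vert^2_{H^{\otimes m}}$. For $\lambda>0$, $\mathcal{G}_\lambda$ is the Hilbert space of (formal, if $\lambda<1$) series $\sum_m\delta^m(f_m)$ with $\sum_m m!\lambda^{2m}\Vert f_m\Vert^2_{H^{\otimes m}}<\infty$. $\mathcal{G}:=\bigcap_{\lambda\ge1}\mathcal{G}_\lambda$ with the projective limit topology; its dual is $\mathcal{G}^*=\bigcup_{\lambda>0}\mathcal{G}_\lambda$, with dual pairing $\langle\langle u,\varphi\rangle\rangle=\sum_m m!\langle u_m,\varphi_m\rangle_{H^{\otimes m}}$, which equals $\int u\varphi\,d\mu$ when $u\in\mathcal{L}^2(\mathbb{R}^n,\mu)$. One has $\mathcal{G}\subset\mathcal{L}^r(\mathbb{R}^n,\mu)$ for every $1\le r<\infty$, and every $u\in\mathcal{L}^q(\mathbb{R}^n,\mu)$ with $q>1$ is regarded as an element of $\mathcal{G}^*$ through $\langle\langle u,\varphi\rangle\rangle=\int u\varphi\,d\mu$.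 Wick product: with $\mathcal{E}(h)(w)=\exp\{\langle w,h\rangle-|h|^2/2\}$, $h\in\mathbb{R}^n$, it is determined by $\mathcal{E}(h)\diamond\mathcal{E}(k)=\mathcal{E}(h+k)$ and bilinearity, and extends to $f,g\in\mathcal{L}^2(\mathbb{R}^n,\mu)$ with values in $\mathcal{G}^*$ by $f\diamond g=\sum_{m\ge0}\delta^m\big(\sum_{j=0}^m f_j\hat\otimes g_{m-j}\big)$. Here $\cdot$ is the point-wise product and $\partial_{x_k}$ is the partial derivative with respect to the $k$-th coordinate. Under the hypotheses all terms above are elements of $\mathcal{G}^*$. *)

theory Defs
  imports "HOL-Probability.Probability" "HOL-Combinatorics.Permutations"
begin

definition gauss :: "(real ^ 'n) measure" where
  "gauss = density lborel
     (\<lambda>w. ennreal ((2 * pi) powr (- real CARD('n) / 2) * exp (- (norm w)\<^sup>2 / 2)))"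

text \<open>Functions stand for their almost-everywhere classes.\<close>

definition Lspace :: "real \<Rightarrow> (real ^ 'n \<Rightarrow> real) set" where
  "Lspace q = {f. f \<in> borel_measurable gauss \<and> integrable gauss (\<lambda>w. \<bar>f w\<bar> powr q)}"

text \<open>
  A tensor in the \<open>m\<close>-th tensor power of the space \<open>real ^ 'n\<close> is given by its coordinates
  in the canonical basis, indexed by the lists of basis indices of length \<open>m\<close>; it is
  extended by \<open>0\<close> to lists of any other length, so that a tensor is determined as a function.
\<close>

type_synonym 'n tensor = "'n list \<Rightarrow> real"

definition sym_tensors :: "nat \<Rightarrow> 'n tensor set" where
  "sym_tensors m = {t. (\<forall>xs. length xs \<noteq> m \<longrightarrow> t xs = 0) \<and>
     (\<forall>xs \<sigma>. \<sigma> permutes {..<length xs} \<longrightarrow> t (permute_list \<sigma> xs) = t xs)}"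

definition tensor_inner :: "nat \<Rightarrow> ('n::finite) tensor \<Rightarrow> 'n tensor \<Rightarrow> real" where
  "tensor_inner m s t = (\<Sum>xs | length xs = m. s xs * t xs)"

definition tensor_prod :: "nat \<Rightarrow> 'n tensor \<Rightarrow> 'n tensor \<Rightarrow> 'n tensor" where
  "tensor_prod j s t = (\<lambda>xs. s (take j xs) * t (drop j xs))"

definition symmetrize :: "'n tensor \<Rightarrow> 'n tensor" where
  "symmetrize t = (\<lambda>xs. (\<Sum>\<sigma> | \<sigma> permutes {..<length xs}. t (permute_list \<sigma> xs))
                          / fact (length xs))"

text \<open>The probabilists' Hermite polynomials (leading coefficient 1).\<close>

fun hermite :: "nat \<Rightarrow> real \<Rightarrow> real" where
  "hermite 0 x = 1"
| "hermite (Suc 0) x = x"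
| "hermite (Suc (Suc k)) x = x * hermite (Suc k) x - real (Suc k) * hermite k x"

text \<open>
  The multiple Wiener-Ito integral of order \<open>m\<close>: it is the linear map that sends the
  symmetrization of a product of canonical basis vectors, in which the \<open>k\<close>-th vector occurs
  \<open>a k\<close> times, to the product over \<open>k\<close> of the Hermite polynomials of degree \<open>a k\<close>
  in the \<open>k\<close>-th coordinate.
\<close>

definition wiener_ito :: "nat \<Rightarrow> ('n::finite) tensor \<Rightarrow> real ^ 'n \<Rightarrow> real" where
  "wiener_ito m t w =
     (\<Sum>xs | length xs = m. t xs * (\<Prod>k\<in>UNIV. hermite (count_list xs k) (w $ k)))"

text \<open>Formal chaos series are represented by their sequence of kernels.\<close>

type_synonym 'n chaos_series = "nat \<Rightarrow> 'n tensor"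

definition has_chaos_expansion :: "(real ^ 'n \<Rightarrow> real) \<Rightarrow> 'n chaos_series \<Rightarrow> bool" where
  "has_chaos_expansion f u \<longleftrightarrow>
     f \<in> Lspace 2 \<and> (\<forall>m. u m \<in> sym_tensors m) \<and>
     (\<lambda>N. LINT w|gauss. (f w - (\<Sum>m<N. wiener_ito m (u m) w))\<^sup>2) \<longlonglongrightarrow> 0"

definition chaos :: "(real ^ 'n \<Rightarrow> real) \<Rightarrow> 'n chaos_series" where
  "chaos f = (THE u. has_chaos_expansion f u)"

definition G_lambda :: "real \<Rightarrow> ('n::finite) chaos_series set" where
  "G_lambda l = {u. (\<forall>m. u m \<in> sym_tensors m) \<and>
     summable (\<lambda>m. fact m * l ^ (2 * m) * tensor_inner m (u m) (u m))}"

text \<open>For \<open>l \<ge> 1\<close> the series in \<open>G_lambda l\<close> converge in the mean square, so the elements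
  of the intersection of these spaces are taken to be actual functions.\<close>

definition G_space :: "(real ^ 'n \<Rightarrow> real) set" where
  "G_space = {\<phi>. \<exists>u. has_chaos_expansion \<phi> u \<and> (\<forall>l\<ge>1. u \<in> G_lambda l)}"

definition G_star :: "('n::finite) chaos_series set" where
  "G_star = (\<Union>l\<in>{0<..}. G_lambda l)"

definition dual_pairing :: "('n::finite) chaos_series \<Rightarrow> (real ^ 'n \<Rightarrow> real) \<Rightarrow> real" where
  "dual_pairing u \<phi> = (\<Sum>m. fact m * tensor_inner m (u m) (chaos \<phi> m))"

text \<open>The action on \<open>G_space\<close> of a function in \<open>Lspace q\<close>, \<open>q > 1\<close>, as an element of the dual.\<close>

definition fun_pairing :: "(real ^ 'n \<Rightarrow> real) \<Rightarrow> (real ^ 'n \<Rightarrow> real) \<Rightarrow> real" where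
  "fun_pairing u \<phi> = (LINT w|gauss. u w * \<phi> w)"

definition wick :: "(real ^ 'n \<Rightarrow> real) \<Rightarrow> (real ^ 'n \<Rightarrow> real) \<Rightarrow> 'n chaos_series" where
  "wick f g = (\<lambda>m xs. \<Sum>j\<le>m. symmetrize (tensor_prod j (chaos f j) (chaos g (m - j))) xs)"

definition partial_deriv :: "'n \<Rightarrow> (real ^ 'n \<Rightarrow> real) \<Rightarrow> real ^ 'n \<Rightarrow> real" where
  "partial_deriv k f w = deriv (\<lambda>t. f (w + t *\<^sub>R axis k 1)) 0"

definition xi :: "(real ^ 'n) measure \<Rightarrow> real ^ 'n \<Rightarrow> real" where
  "xi \<nu> w = (LINT y|\<nu>. exp (w \<bullet> y - (norm y)\<^sup>2 / 2))"

end

theory Submission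
  imports Defs "HOL-Combinatorics.Multiset_Permutations"
begin

text \<open>
  Write \<open>E h\<close> for \<open>wick_exp h\<close>.  Integrating \<open>E y * E z = exp (y \<bullet> z) * E (y + z)\<close> and
  \<open>E y \<diamond> E z = E (y + z)\<close> over \<open>\<nu>1 \<Otimes>\<^sub>M \<nu>2\<close>, and using that differentiating \<open>E y\<close> in the \<open>k\<close>-th
  coordinate multiplies it by \<open>y $ k\<close>, the three pairings with a test function \<open>\<phi>\<close> become the
  integrals of \<open>exp (y \<bullet> z)\<close>, \<open>1\<close> and \<open>y \<bullet> z\<close> against \<open>S (y + z)\<close>, where
  \<open>S h = \<integral> \<phi> * E h d\<mu>\<close> is nonnegative when \<open>\<phi>\<close> is.  The claim is then \<open>exp t \<ge> 1 + t\<close>.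
\<close>

section \<open>Hermite polynomials and the Gaussian measure\<close>

text \<open>Wick product and dual pairing are defined through \<open>chaos\<close>, a definite
  description, so kernels have to be computed before anything can be paired. Both \<open>xi\<close>
  and its partial derivatives are mixtures of \<open>E y\<close> with a weight a(y), namely 1 or y $
  k, and one computation with a general weight serves both. As the mean-square norm of
  \<open>E y\<close> is exp (|y|^2 / 2), it asks for |a(y)| exp (|y|^2 / 2) to be integrable; the
  strict inequality 2 < p pays for the factor y $ k.

  The obstacle is that the pairings live on different scales. Because |y + z|^2 \<le> 2 (|y|^2 +
  |z|^2), the squared norm exp (l^2 |y + z|^2) of \<open>E (y + z)\<close> in
  \<open>G_lambda l\<close> is under control for l = 1/2, and the Wick pairings get by with test
  functions from \<open>G_lambda 2\<close>. In the pointwise product, exp (y \<bullet> z) alone may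
  use up exp ((|y|^2 + |z|^2) / 2), so the surplus (p - 2) / 2 of the exponent has to absorb the
  growth exp (|y + z|^2 / l^2) of \<open>S\<close>. In this estimate l grows without bound as p
  approaches 2; this is where membership in \<open>G_lambda l\<close> for arbitrarily large l
  enters.\<close>

fun hermite_poly :: "nat \<Rightarrow> real poly" where
  "hermite_poly 0 = 1"
| "hermite_poly (Suc 0) = [:0, 1:]"
| "hermite_poly (Suc (Suc k)) =
     [:0, 1:] * hermite_poly (Suc k) - smult (real (Suc k)) (hermite_poly k)"

lemma poly_hermite_poly: "poly (hermite_poly a) = hermite a"
proof (rule ext)
  show "poly (hermite_poly a) x = hermite a x" for x
    by (induction a x rule: hermite.induct) auto
qed

lemma pderiv_hermite_poly: "pderiv (hermite_poly (Suc a)) = smult (real (Suc a)) (hermite_poly a)"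
proof (induction a rule: less_induct)
  case (less a)
  show ?case
  proof (cases a)
    case (Suc b)
    have IH: "pderiv (hermite_poly (Suc b)) = smult (real (Suc b)) (hermite_poly b)"
      using less.IH[of b] Suc by simp
    \<comment> \<open>This is \<open>hermite_poly_Suc\<close> at \<open>b\<close>, which in general
      is a consequence of the present lemma; here the induction hypothesis for the predecessor of
      \<open>b\<close> supplies it.\<close>
    have rec: "smult (real (Suc b)) ([:0, 1:] * hermite_poly b - pderiv (hermite_poly b))
        = smult (real (Suc b)) (hermite_poly (Suc b))"
    proof (cases b)
      case (Suc c)
      then show ?thesis
        using less.IH[of c] \<open>a = Suc b\<close> by simp
    qed simp
    have "pderiv (hermite_poly (Suc a)) = hermite_poly (Suc b) +
        smult (real (Suc b)) ([:0, 1:] * hermite_poly b - pderiv (hermite_poly b))"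
      using Suc IH
      by (simp add: pderiv_mult pderiv_diff pderiv_smult pderiv_pCons smult_diff_right
          del: mult_pCons_left of_nat_Suc)
    also have "\<dots> = smult (real (Suc a)) (hermite_poly (Suc b))"
    proof -
      have "real (Suc a) = 1 + real (Suc b)" using Suc by simp
      then show ?thesis unfolding rec by (simp only: smult_add_left smult_1_left)
    qed
    finally show ?thesis using Suc by simp
  qed (simp add: pderiv_pCons)
qed

text \<open>The form of the recursion that fits integration by parts: p \<mapsto> x p - p' is the
  adjoint of differentiation under the Gaussian weight.\<close>

lemma hermite_poly_Suc:
  "hermite_poly (Suc a) = [:0, 1:] * hermite_poly a - pderiv (hermite_poly a)"
  by (cases a) (simp_all add: pderiv_hermite_poly del: mult_pCons_left of_nat_Suc)

section \<open>Gaussian integration by parts and one-dimensional Hermite integrals\<close>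

lemma integrable_std_normal_poly: "integrable lborel (\<lambda>x. std_normal_density x * poly p x)"
  unfolding poly_altdef sum_distrib_left mult.left_commute[of "std_normal_density _"]
  by (intro Bochner_Integration.integrable_sum integrable_mult_right integrable_std_normal_moment)

text \<open>Both terms are moments of the standard normal law. For even \<open>k\<close> they are
  odd moments and vanish (for \<open>k = 0\<close> the second one vanishes by its factor
  \<open>k\<close>); for odd \<open>k\<close> they agree, because consecutive even moments differ by
  exactly the factor \<open>k\<close>.\<close>

lemma has_integral_Stein_monom:
  "has_bochner_integral lborel
     (\<lambda>x. std_normal_density x * (x * x ^ k - real k * x ^ (k - 1))) 0"
proof (cases "even k")
  case True
  then obtain j where k: "k = 2 * j" by (elim evenE)
  have 1: "has_bochner_integral lborel (\<lambda>x. std_normal_density x * (x * x ^ k)) 0"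
    using std_normal_moment_odd[of j] by (simp add: k)
  have 2: "has_bochner_integral lborel (\<lambda>x. std_normal_density x * (real k * x ^ (k - 1))) 0"
  proof (cases j)
    case (Suc i)
    then show ?thesis
      using has_bochner_integral_mult_right[of "real k", OF std_normal_moment_odd[of i]]
      by (simp add: k mult_ac)
  qed (simp add: k has_bochner_integral_zero)
  show ?thesis
    using has_bochner_integral_diff[OF 1 2] by (simp add: right_diff_distrib)
next
  case False
  then obtain j where k: "k = 2 * j + 1" by (elim oddE)
  have 1: "has_bochner_integral lborel (\<lambda>x. std_normal_density x * (x * x ^ k))
      (fact (2 * Suc j) / (2 ^ Suc j * fact (Suc j)))"
    using std_normal_moment_even[of "Suc j"] by (simp add: k)
  have 2: "has_bochner_integral lborel (\<lambda>x. std_normal_density x * (real k * x ^ (k - 1)))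
      (real k * (fact (2 * j) / (2 ^ j * fact j)))"
    using has_bochner_integral_mult_right[of "real k", OF std_normal_moment_even[of j]]
    by (simp add: k mult_ac)
  have 3: "fact (2 * Suc j) / (2 ^ Suc j * fact (Suc j)) = real k * (fact (2 * j) / (2 ^ j * fact j))"
  proof -
    have "fact (2 * Suc j) = (2 * (real j + 1)) * (2 * real j + 1) * fact (2 * j)"
      by (simp add: algebra_simps)
    moreover have "2 ^ Suc j * fact (Suc j) = (2 * (real j + 1)) * (2 ^ j * fact j)"
      by (simp add: algebra_simps)
    moreover have "2 * (real j + 1) \<noteq> 0"
      by (simp add: add_nonneg_eq_0_iff)
    ultimately have "fact (2 * Suc j) / (2 ^ Suc j * fact (Suc j))
        = ((2 * real j + 1) * fact (2 * j)) / (2 ^ j * fact j)"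
      by (metis mult.assoc mult_divide_mult_cancel_left)
    then show ?thesis by (simp add: k)
  qed
  show ?thesis
    using has_bochner_integral_diff[OF 1 2] unfolding 3 by (simp add: right_diff_distrib)
qed

text \<open>Stein's identity; by linearity the monomials suffice.\<close>

lemma has_integral_Stein:
  "has_bochner_integral lborel
     (\<lambda>x. std_normal_density x * (x * poly p x - poly (pderiv p) x)) 0"
proof -
  let ?S = "\<lambda>p. has_bochner_integral lborel
     (\<lambda>x. std_normal_density x * (x * poly p x - poly (pderiv p) x)) 0"
  have add: "?S (p + q)" if "?S p" "?S q" for p q
    using has_bochner_integral_add[OF that] by (simp add: pderiv_add algebra_simps)
  have monom: "?S (monom c k)" for c k
    using has_bochner_integral_mult_right[of c, OF has_integral_Stein_monom[of k]]
    by (simp add: poly_monom pderiv_monom algebra_simps)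
  have "?S (\<Sum>i\<in>A. monom (coeff p i) i)" if "finite A" for A
    using that
  proof (induction A rule: finite_induct)
    case empty
    then show ?case by (simp add: has_bochner_integral_zero)
  next
    case (insert i A)
    show ?case unfolding sum.insert[OF insert.hyps] by (rule add[OF monom insert.IH])
  qed
  from this[OF finite_atMost[of "degree p"]] show ?thesis
    by (simp only: poly_as_sum_of_monoms)
qed

lemma integral_Stein:
  "(LBINT x. std_normal_density x * (x * poly p x)) = (LBINT x. std_normal_density x * poly (pderiv p) x)"
proof -
  have "integrable lborel (\<lambda>x. std_normal_density x * poly ([:0, 1:] * p) x)"
    by (rule integrable_std_normal_poly)
  then have 1: "integrable lborel (\<lambda>x. std_normal_density x * (x * poly p x))"
    by simp
  show ?thesis
    using has_bochner_integral_integral_eq[OF has_integral_Stein[of p]]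
      Bochner_Integration.integral_diff[OF 1 integrable_std_normal_poly[of "pderiv p"]]
    by (simp add: right_diff_distrib)
qed

text \<open>Raising the degree of one factor is adjoint to differentiating the other one. Hence both
  degrees drop by one at the price of the factor \<open>b\<close>, until one of them is 0.\<close>

lemma has_integral_hermite_hermite:
  "has_bochner_integral lborel (\<lambda>x. std_normal_density x * (hermite a x * hermite b x))
     (if a = b then fact a else 0)"
proof -
  have int: "integrable lborel (\<lambda>x. std_normal_density x * (hermite a x * hermite b x))" for a b
    using integrable_std_normal_poly[of "hermite_poly a * hermite_poly b"]
    by (simp add: poly_hermite_poly)
  define I where "I a b = (LBINT x. std_normal_density x * (hermite a x * hermite b x))" for a b
  have step: "I (Suc a) b = (LBINT x. std_normal_density x * poly (hermite_poly a * pderiv (hermite_poly b)) x)"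
    for a b
  proof -
    let ?p = "hermite_poly a * hermite_poly b"
    have i: "integrable lborel (\<lambda>x. std_normal_density x * (x * poly ?p x))"
      using integrable_std_normal_poly[of "[:0, 1:] * ?p"] by simp
    have "I (Suc a) b = (LBINT x. std_normal_density x * (x * poly ?p x) -
        std_normal_density x * poly (pderiv (hermite_poly a) * hermite_poly b) x)"
      unfolding I_def poly_hermite_poly[symmetric] hermite_poly_Suc
      by (simp add: algebra_simps)
    also have "\<dots> = (LBINT x. std_normal_density x * poly (pderiv ?p) x) -
        (LBINT x. std_normal_density x * poly (pderiv (hermite_poly a) * hermite_poly b) x)"
      using Bochner_Integration.integral_diff[OF i integrable_std_normal_poly] integral_Stein
      by presburger
    also have "\<dots> = (LBINT x. std_normal_density x * poly (pderiv ?p) x -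
        std_normal_density x * poly (pderiv (hermite_poly a) * hermite_poly b) x)"
      by (rule Bochner_Integration.integral_diff[symmetric]; rule integrable_std_normal_poly)
    also have "\<dots> = (LBINT x. std_normal_density x * poly (hermite_poly a * pderiv (hermite_poly b)) x)"
      by (simp add: pderiv_mult algebra_simps)
    finally show ?thesis .
  qed
  have "I a b = (if a = b then fact a else 0)"
  proof (induction a arbitrary: b)
    case 0
    show ?case
    proof (cases b)
      case 0
      then show ?thesis by (simp add: I_def)
    next
      case (Suc c)
      \<comment> \<open>By symmetry the positive degree is moved to the first argument; the
        derivative then falls on the constant 1.\<close>
      have "I 0 b = I (Suc c) 0" by (simp add: I_def Suc)
      also have "\<dots> = 0" by (simp only: step) simp
      finally show ?thesis by (simp add: Suc)
    qed
  next
    case (Suc a)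
    show ?case
    proof (cases b)
      case 0
      then show ?thesis using step[of a 0] by simp
    next
      case (Suc c)
      have "I (Suc a) b = (LBINT x. real (Suc c) * (std_normal_density x * (hermite a x * hermite c x)))"
        by (simp add: step Suc pderiv_hermite_poly poly_hermite_poly mult_ac)
      also have "\<dots> = real (Suc c) * I a c" unfolding I_def by (rule integral_mult_right_zero)
      finally show ?thesis using Suc.IH[of c] by (simp add: Suc)
    qed
  qed
  then show ?thesis
    using int[of a b] by (simp add: I_def has_bochner_integral_iff)
qed

text \<open>The exponential factor turns the standard normal density into the one with mean
  \<open>h\<close>, so the integral equals that of \<open>hermite a (h + x)\<close> against the
  standard density. There each further degree contributes a factor \<open>h\<close>.\<close>

lemma has_integral_hermite_exp:
  "has_bochner_integral lborel (\<lambda>x. std_normal_density x * (exp (h * x - h\<^sup>2 / 2) * hermite a x)) (h ^ a)"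
proof -
  let ?q = "\<lambda>a. pcompose (hermite_poly a) [:h, 1:]"
  have q: "poly (?q a) x = hermite a (h + x)" for a x
    by (simp add: poly_pcompose poly_hermite_poly)
  have "(LBINT x. std_normal_density x * poly (?q a) x) = h ^ a"
  proof (induction a)
    case 0
    show ?case by (simp add: pcompose_1)
  next
    case (Suc a)
    have pd: "pderiv (?q a) = pcompose (pderiv (hermite_poly a)) [:h, 1:]"
      by (simp add: pderiv_pcompose pderiv_pCons)
    have i: "integrable lborel (\<lambda>x. std_normal_density x * (x * poly (?q a) x))"
      using integrable_std_normal_poly[of "[:0, 1:] * ?q a"] by simp
    \<comment> \<open>With q = \<open>?q a\<close> the recursion reads (h + x) q - q' = h q + (x q -
      q'), and the bracket integrates to 0 by Stein's identity.\<close>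
    have "(LBINT x. std_normal_density x * poly (?q (Suc a)) x) =
        (LBINT x. h * (std_normal_density x * poly (?q a) x) +
          (std_normal_density x * (x * poly (?q a) x) - std_normal_density x * poly (pderiv (?q a)) x))"
      unfolding pd hermite_poly_Suc by (simp add: pcompose_diff pcompose_mult algebra_simps pcompose_pCons)
    also have "\<dots> = h * h ^ a + 0"
      using i integrable_std_normal_poly[of "?q a"] integrable_std_normal_poly[of "pderiv (?q a)"]
      by (simp add: Suc.IH integral_Stein)
    finally show ?case by simp
  qed
  then have "has_bochner_integral lborel (\<lambda>x. std_normal_density x * hermite a (h + x)) (h ^ a)"
    using integrable_std_normal_poly[of "?q a"] by (simp add: q has_bochner_integral_iff)
  moreover have "std_normal_density (h + 1 * x) * exp (h * (h + 1 * x) - h\<^sup>2 / 2)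
      = std_normal_density x" for x
    by (simp add: std_normal_density_def mult_exp_exp power2_eq_square field_simps)
  ultimately show ?thesis
    by (subst lborel_has_bochner_integral_real_affine_iff[where c = 1 and t = h])
       (simp_all flip: mult.assoc)
qed

section \<open>Factorization of integrals over the coordinates\<close>

lemma has_integral_lborel_prod:
  fixes f :: "'n::finite \<Rightarrow> real \<Rightarrow> real"
  assumes "\<And>k. has_bochner_integral lborel (f k) (I k)"
  shows "has_bochner_integral lborel (\<lambda>w :: real ^ 'n. \<Prod>k\<in>UNIV. f k (w $ k)) (\<Prod>k\<in>UNIV. I k)"
proof -
  \<comment> \<open>\<open>lborel\<close> on a Euclidean space is a product indexed by
    \<open>Basis\<close>, so every basis vector has to be translated back to its coordinate.\<close>
  let ?g = "\<lambda>b :: real ^ 'n. f (THE k. b = axis k 1)"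
  have the: "(THE k. axis j (1 :: real) = axis k 1) = j" for j :: 'n
    by (rule the_equality) (auto simp: axis_eq_axis)
  have inj: "inj (\<lambda>k :: 'n. axis k (1 :: real))"
    by (auto simp: inj_def axis_eq_axis)
  have Basis: "(Basis :: (real ^ 'n) set) = range (\<lambda>k. axis k 1)"
    by (auto simp: Basis_vec_def)
  have int: "integrable lborel (?g b)" if "b \<in> Basis" for b
    using that assms by (auto simp: Basis the has_bochner_integral_iff)
  have prod_Basis: "(\<Prod>b\<in>Basis. F b) = (\<Prod>k\<in>UNIV. F (axis k 1))" for F :: "real ^ 'n \<Rightarrow> real"
    unfolding Basis by (simp add: prod.reindex inj)
  interpret product_sigma_finite "\<lambda>b :: real ^ 'n. lborel :: real measure" ..
  have meas: "(\<lambda>w :: real ^ 'n. \<Prod>k\<in>UNIV. f k (w $ k)) \<in> borel_measurable borel"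
  proof -
    have [measurable]: "f k \<in> borel_measurable borel" for k
      using assms[of k] by (auto simp: has_bochner_integral_iff)
    show ?thesis by measurable
  qed
  have comp: "(\<Prod>k\<in>UNIV. f k ((\<Sum>b\<in>Basis. x b *\<^sub>R b) $ k)) = (\<Prod>b\<in>Basis. ?g b (x b))"
    for x :: "real ^ 'n \<Rightarrow> real"
  proof -
    have "(\<Sum>b\<in>Basis. x b *\<^sub>R b) $ k = x (axis k 1)" for k
    proof -
      have "(\<Sum>b\<in>Basis. x b *\<^sub>R b) \<bullet> axis k 1 = x (axis k 1)"
        by (rule inner_sum_left_Basis) (auto simp: Basis)
      then show ?thesis by (simp add: inner_axis)
    qed
    then show ?thesis by (simp add: prod_Basis the)
  qed
  have T: "(\<lambda>f. \<Sum>b\<in>Basis. f b *\<^sub>R b) \<in> (\<Pi>\<^sub>M b\<in>(Basis :: (real ^ 'n) set). lborel) \<rightarrow>\<^sub>M borel"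
    by measurable
  have "integrable (\<Pi>\<^sub>M b\<in>(Basis :: (real ^ 'n) set). lborel) (\<lambda>x. \<Prod>b\<in>Basis. ?g b (x b))"
    by (rule product_integrable_prod) (auto intro: int)
  moreover have "(\<integral>x. (\<Prod>b\<in>Basis. ?g b (x b)) \<partial>(\<Pi>\<^sub>M b\<in>(Basis :: (real ^ 'n) set). lborel)) = (\<Prod>k\<in>UNIV. I k)"
    by (subst product_integral_prod) (use assms int in \<open>auto simp: prod_Basis the has_bochner_integral_iff\<close>)
  ultimately show ?thesis
    unfolding has_bochner_integral_iff lborel_eq[where 'a = "real ^ 'n"]
    using meas
    by (simp add: integrable_distr_eq[OF T] integral_distr[OF T] comp del: sum_component)
qed

lemma gauss_density_eq:
  "(2 * pi) powr (- real CARD('n) / 2) * exp (- (norm w)\<^sup>2 / 2)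
     = (\<Prod>k\<in>UNIV. std_normal_density (w $ k))" for w :: "real ^ 'n::finite"
proof -
  have "(\<Prod>k\<in>UNIV. std_normal_density (w $ k))
      = (1 / sqrt (2 * pi)) ^ CARD('n) * exp (\<Sum>k\<in>UNIV. - (w $ k)\<^sup>2 / 2)"
    unfolding std_normal_density_def prod.distrib by (simp add: exp_sum)
  moreover have "(\<Sum>k\<in>UNIV. - (w $ k)\<^sup>2 / 2) = - (norm w)\<^sup>2 / 2"
    by (simp add: norm_vec_def L2_set_def sum_nonneg sum_negf sum_divide_distrib)
  moreover have "(1 / sqrt (2 * pi)) ^ CARD('n) = (2 * pi) powr (- real CARD('n) / 2)"
  proof -
    have "1 / sqrt (2 * pi) = (2 * pi) powr (- 1 / 2)"
      by (simp add: powr_minus_divide powr_half_sqrt)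
    then show ?thesis
      by (simp add: powr_powr flip: powr_realpow)
  qed
  ultimately show ?thesis by simp
qed

lemma has_integral_gauss_prod:
  fixes f :: "'n::finite \<Rightarrow> real \<Rightarrow> real"
  assumes "\<And>k. has_bochner_integral lborel (\<lambda>x. std_normal_density x * f k x) (I k)"
    and [measurable]: "\<And>k. f k \<in> borel_measurable borel"
  shows "has_bochner_integral gauss (\<lambda>w :: real ^ 'n. \<Prod>k\<in>UNIV. f k (w $ k)) (\<Prod>k\<in>UNIV. I k)"
proof -
  have *: "(\<lambda>w :: real ^ 'n. ((2 * pi) powr (- real CARD('n) / 2) * exp (- (norm w)\<^sup>2 / 2)) *\<^sub>R (\<Prod>k\<in>UNIV. f k (w $ k)))
      = (\<lambda>w. \<Prod>k\<in>UNIV. std_normal_density (w $ k) * f k (w $ k))"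
    unfolding gauss_density_eq by (simp add: prod.distrib)
  show ?thesis
    unfolding gauss_def
  proof (rule has_bochner_integral_density)
    show "has_bochner_integral lborel (\<lambda>w :: real ^ 'n. ((2 * pi) powr (- real CARD('n) / 2)
        * exp (- (norm w)\<^sup>2 / 2)) *\<^sub>R (\<Prod>k\<in>UNIV. f k (w $ k))) (\<Prod>k\<in>UNIV. I k)"
      unfolding * by (rule has_integral_lborel_prod[OF assms(1)])
  qed auto
qed

section \<open>Multiple Wiener-Ito integrals\<close>

text \<open>The entries of the tensor powers of \<open>h\<close>. One function serves all orders;
  the order is fixed where it is used, by \<open>tensor_inner m\<close> or by
  \<open>wick_exp_kernel m\<close>.\<close>

definition coord_prod :: "real ^ 'n \<Rightarrow> 'n list \<Rightarrow> real" where
  "coord_prod h xs = prod_list (map (($) h) xs)"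

definition hermite_prod :: "('n::finite) list \<Rightarrow> real ^ 'n \<Rightarrow> real" where
  "hermite_prod xs w = (\<Prod>k\<in>UNIV. hermite (count_list xs k) (w $ k))"

definition wick_exp :: "real ^ 'n \<Rightarrow> real ^ 'n \<Rightarrow> real" where
  "wick_exp h w = exp (w \<bullet> h - (norm h)\<^sup>2 / 2)"

lemma finite_lists_length: "finite {xs :: 'n::finite list. length xs = m}"
  using finite_lists_length_eq[of "UNIV :: 'n set" m] by simp

lemma sum_lists_length_Suc:
  "(\<Sum>xs | length xs = Suc m. F xs) = (\<Sum>x\<in>UNIV. \<Sum>xs | length xs = m. F (x # xs))"
  for F :: "'n::finite list \<Rightarrow> real"
proof -
  have "(\<Sum>xs | length xs = Suc m. F xs) = (\<Sum>(x, xs)\<in>UNIV \<times> {xs. length xs = m}. F (x # xs))"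
    by (rule sum.reindex_bij_witness[of _ "\<lambda>(x, xs). x # xs" "\<lambda>xs. (hd xs, tl xs)"])
       (auto simp: length_Suc_conv)
  then show ?thesis
    by (simp add: sum.cartesian_product)
qed

lemma coord_prod_simps [simp]:
  "coord_prod h [] = 1" "coord_prod h (x # xs) = h $ x * coord_prod h xs"
  by (simp_all add: coord_prod_def)

lemma sum_coord_prod_mult:
  "(\<Sum>xs | length xs = m. coord_prod g xs * coord_prod h xs) = (g \<bullet> h) ^ m"
  for g h :: "real ^ 'n::finite"
proof (induction m)
  case (Suc m)
  have "(\<Sum>xs | length xs = Suc m. coord_prod g xs * coord_prod h xs)
      = (\<Sum>x\<in>UNIV. \<Sum>xs | length xs = m. (g $ x * h $ x) * (coord_prod g xs * coord_prod h xs))"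
    unfolding sum_lists_length_Suc by (simp add: mult_ac)
  also have "\<dots> = (g \<bullet> h) ^ Suc m"
    by (simp add: Suc.IH inner_vec_def sum_distrib_right flip: sum_distrib_left)
  finally show ?case .
qed simp

lemma coord_prod_count: "coord_prod h xs = (\<Prod>k\<in>UNIV. (h $ k) ^ count_list xs k)"
  for h :: "real ^ 'n::finite"
proof (induction xs)
  case (Cons x xs)
  have "(\<Prod>k\<in>UNIV. (h $ k) ^ count_list (x # xs) k)
      = (\<Prod>k\<in>UNIV. (if x = k then h $ k else 1) * (h $ k) ^ count_list xs k)"
    by (rule prod.cong) auto
  also have "\<dots> = h $ x * (\<Prod>k\<in>UNIV. (h $ k) ^ count_list xs k)"
    by (simp add: prod.distrib)
  finally show ?case using Cons by simp
qed simp

lemma coord_prod_permute_list: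
  "\<sigma> permutes {..<length xs} \<Longrightarrow> coord_prod h (permute_list \<sigma> xs) = coord_prod h xs"
  for h :: "real ^ 'n::finite"
  unfolding coord_prod_count by (metis count_mset mset_permute_list)

lemma sum_coord_prod_power2: "(\<Sum>xs | length xs = m. (coord_prod h xs)\<^sup>2) = (norm h) ^ (2 * m)"
  for h :: "real ^ 'n::finite"
  using sum_coord_prod_mult[of h h m]
  by (simp add: power2_eq_square power_mult flip: power2_norm_eq_inner)

section \<open>Symmetric tensors and their integrals\<close>

lemma sym_tensors_mset_eq:
  assumes "t \<in> sym_tensors m" "mset xs = mset ys"
  shows "t xs = t ys"
proof -
  obtain \<sigma> where "\<sigma> permutes {..<length ys}" "permute_list \<sigma> ys = xs"
    using mset_eq_permutation[OF assms(2)] .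
  then show ?thesis using assms(1) by (auto simp: sym_tensors_def)
qed

lemma sym_tensorsI:
  assumes "\<And>xs. length xs \<noteq> m \<Longrightarrow> t xs = 0"
    and "\<And>xs \<sigma>. \<sigma> permutes {..<length xs} \<Longrightarrow> t (permute_list \<sigma> xs) = t xs"
  shows "t \<in> sym_tensors m"
  using assms by (auto simp: sym_tensors_def)

lemma sym_tensors_0: "t \<in> sym_tensors m \<Longrightarrow> length xs \<noteq> m \<Longrightarrow> t xs = 0"
  by (auto simp: sym_tensors_def)

lemma sym_tensors_diff:
  "s \<in> sym_tensors m \<Longrightarrow> t \<in> sym_tensors m \<Longrightarrow> (\<lambda>xs. s xs - t xs) \<in> sym_tensors m"
  by (auto simp: sym_tensors_def)

lemma wiener_ito_hermite_prod:
  "wiener_ito m t w = (\<Sum>xs | length xs = m. t xs * hermite_prod xs w)"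
  by (simp add: wiener_ito_def hermite_prod_def)

lemma wiener_ito_diff: "wiener_ito m (\<lambda>xs. s xs - t xs) w = wiener_ito m s w - wiener_ito m t w"
  by (simp add: wiener_ito_def left_diff_distrib sum_subtractf)

lemma borel_measurable_hermite [measurable]: "hermite a \<in> borel_measurable borel"
proof -
  have "continuous_on UNIV (poly (hermite_poly a))"
    by (intro continuous_intros)
  then show ?thesis unfolding poly_hermite_poly by (rule borel_measurable_continuous_onI)
qed

lemma sets_gauss [simp, measurable_cong]: "sets gauss = sets borel"
  by (simp add: gauss_def)

lemma space_gauss [simp]: "space gauss = UNIV"
  by (simp add: gauss_def)

lemma borel_measurable_hermite_prod [measurable]: "hermite_prod xs \<in> borel_measurable borel"
  unfolding hermite_prod_def[abs_def] by measurable

lemma borel_measurable_wiener_ito [measurable]: "wiener_ito m t \<in> borel_measurable borel"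
  unfolding wiener_ito_hermite_prod[abs_def] by measurable

lemma borel_measurable_wick_exp [measurable]: "wick_exp h \<in> borel_measurable borel"
  unfolding wick_exp_def[abs_def] by measurable

lemma wick_exp_pos [simp]: "0 < wick_exp h w"
  by (simp add: wick_exp_def)

section \<open>Gaussian integrals of Wick exponentials\<close>

lemma wick_exp_prod: "wick_exp h w = (\<Prod>k\<in>UNIV. exp (h $ k * w $ k - (h $ k)\<^sup>2 / 2))"
  for h :: "real ^ 'n::finite"
  by (simp add: wick_exp_def inner_vec_def norm_vec_def L2_set_def sum_nonneg mult_ac
      sum_subtractf sum_divide_distrib flip: exp_sum)

lemma wick_exp_mult: "wick_exp g w * wick_exp h w = exp (g \<bullet> h) * wick_exp (g + h) w"
  by (simp add: wick_exp_def mult_exp_exp power2_norm_eq_inner inner_simps inner_commute field_simps)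

lemma has_integral_wick_exp_hermite_prod:
  "has_bochner_integral gauss (\<lambda>w. wick_exp h w * hermite_prod xs w) (coord_prod h xs)"
  unfolding wick_exp_prod hermite_prod_def coord_prod_count prod.distrib[symmetric]
  by (rule has_integral_gauss_prod[of "\<lambda>k x. exp (h $ k * x - (h $ k)\<^sup>2 / 2) * hermite (count_list xs k) x",
        OF has_integral_hermite_exp]) measurable

lemma has_integral_wick_exp: "has_bochner_integral gauss (wick_exp h) 1"
  using has_integral_wick_exp_hermite_prod[of h "[]"] by (simp add: hermite_prod_def)

lemma has_integral_wick_exp_wick_exp:
  "has_bochner_integral gauss (\<lambda>w. wick_exp g w * wick_exp h w) (exp (g \<bullet> h))"
  unfolding wick_exp_mult
  using has_bochner_integral_mult_right[of "exp (g \<bullet> h)", OF has_integral_wick_exp[of "g + h"]] by simp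

lemma has_integral_wick_exp_power2:
  "has_bochner_integral gauss (\<lambda>w. (wick_exp h w)\<^sup>2) (exp ((norm h)\<^sup>2))"
  unfolding power2_norm_eq_inner power2_eq_square[of "wick_exp _ _"]
  by (rule has_integral_wick_exp_wick_exp)

lemma prob_space_gauss: "prob_space (gauss :: (real ^ 'n::finite) measure)"
proof
  have "has_bochner_integral gauss (\<lambda>_ :: real ^ 'n. 1 :: real) 1"
    using has_integral_wick_exp[of "0 :: real ^ 'n"] by (simp add: wick_exp_def[abs_def])
  then have "nn_integral (gauss :: (real ^ 'n) measure) (\<lambda>_. ennreal 1) = ennreal 1"
    by (subst nn_integral_eq_integral) (auto simp only: has_bochner_integral_iff AE_I2 zero_le_one)
  then show "emeasure gauss (space gauss :: (real ^ 'n) set) = 1"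
    by simp
qed

section \<open>The Ito isometry\<close>

lemma has_integral_hermite_prod_hermite_prod:
  "has_bochner_integral gauss (\<lambda>w. hermite_prod xs w * hermite_prod ys w)
     (if mset xs = mset ys then \<Prod>k\<in>UNIV. fact (count_list xs k) else 0)"
proof -
  have "has_bochner_integral gauss (\<lambda>w. \<Prod>k\<in>UNIV. hermite (count_list xs k) (w $ k) * hermite (count_list ys k) (w $ k))
     (\<Prod>k\<in>UNIV. if count_list xs k = count_list ys k then fact (count_list xs k) else 0)"
    by (rule has_integral_gauss_prod[of "\<lambda>k x. hermite (count_list xs k) x * hermite (count_list ys k) x",
        OF has_integral_hermite_hermite]) measurable
  moreover have "(\<Prod>k\<in>UNIV. if count_list xs k = count_list ys k then fact (count_list xs k) else 0)
      = (if mset xs = mset ys then \<Prod>k\<in>UNIV. fact (count_list xs k) else (0 :: real))"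
  proof (cases "mset xs = mset ys")
    case True
    then have "count_list xs k = count_list ys k" for k by (simp flip: count_mset)
    with True show ?thesis by simp
  next
    case False
    then obtain k where "count_list xs k \<noteq> count_list ys k"
      by (auto simp: multiset_eq_iff count_mset)
    with False show ?thesis by (auto intro!: prod_zero)
  qed
  ultimately show ?thesis
    by (simp add: hermite_prod_def prod.distrib)
qed

lemma has_integral_wick_exp_wiener_ito:
  "has_bochner_integral gauss (\<lambda>w. wick_exp h w * wiener_ito m t w) (tensor_inner m t (coord_prod h))"
proof -
  have "has_bochner_integral gauss (\<lambda>w. \<Sum>xs | length xs = m. t xs * (wick_exp h w * hermite_prod xs w))
      (\<Sum>xs | length xs = m. t xs * coord_prod h xs)"
    by (intro has_bochner_integral_sum has_bochner_integral_mult_right has_integral_wick_exp_hermite_prod)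
  then show ?thesis
    by (simp add: wiener_ito_hermite_prod tensor_inner_def sum_distrib_left mult.left_commute)
qed

text \<open>This is where the factor m! of the isometry comes from. A symmetric tensor is constant
  on the rearrangements of \<open>xs\<close>, whose number is m! divided by the factorials of the
  multiplicities, and these factorials are the square norms of the Hermite products.\<close>

lemma sum_mset_eq_fact:
  fixes t :: "'n::finite tensor"
  assumes t: "t \<in> sym_tensors m" and xs: "length xs = m"
  shows "(\<Sum>ys | length ys = m. t ys * (if mset xs = mset ys then \<Prod>k\<in>UNIV. fact (count_list xs k) else 0))
    = fact m * t xs"
proof -
  let ?P = "\<Prod>k\<in>UNIV. fact (count_list xs k) :: real"
  have P: "?P = real (\<Prod>k\<in>set_mset (mset xs). fact (count (mset xs) k))"
  proof -
    have "?P = (\<Prod>k\<in>set xs. fact (count_list xs k))"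
      by (rule prod.mono_neutral_right) (auto simp: count_list_0_iff)
    then show ?thesis by (simp add: count_mset)
  qed
  have "(\<Sum>ys | length ys = m. t ys * (if mset xs = mset ys then ?P else 0))
      = (\<Sum>ys\<in>permutations_of_multiset (mset xs). t xs * ?P)"
  proof (rule sum.mono_neutral_cong_right)
    show "permutations_of_multiset (mset xs) \<subseteq> {ys. length ys = m}"
      using xs by (auto simp: permutations_of_multiset_def dest: mset_eq_length)
    show "t ys * (if mset xs = mset ys then ?P else 0) = t xs * ?P"
      if "ys \<in> permutations_of_multiset (mset xs)" for ys
      using that sym_tensors_mset_eq[OF t, of ys xs] by (auto simp: permutations_of_multiset_def)
  qed (auto simp: finite_lists_length permutations_of_multiset_def)
  also have "\<dots> = real (card (permutations_of_multiset (mset xs)) *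
      (\<Prod>k\<in>set_mset (mset xs). fact (count (mset xs) k))) * t xs"
    unfolding P by simp
  also have "\<dots> = fact m * t xs"
    unfolding card_permutations_of_multiset_aux by (simp add: xs)
  finally show ?thesis .
qed

text \<open>Different orders are orthogonal because lists of different lengths cannot have the same
  multiset; for equal orders the inner sum collapses by \<open>sum_mset_eq_fact\<close>.\<close>

lemma has_integral_wiener_ito_wiener_ito:
  assumes t: "t \<in> sym_tensors k"
  shows "has_bochner_integral gauss (\<lambda>w. wiener_ito m s w * wiener_ito k t w)
    (if m = k then fact m * tensor_inner m s t else 0)"
proof -
  let ?c = "\<lambda>xs ys. if mset xs = mset ys then \<Prod>k\<in>UNIV. fact (count_list xs k) else 0 :: real"
  have "has_bochner_integral gauss
      (\<lambda>w. \<Sum>xs | length xs = m. s xs * (\<Sum>ys | length ys = k. t ys * (hermite_prod xs w * hermite_prod ys w)))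
      (\<Sum>xs | length xs = m. s xs * (\<Sum>ys | length ys = k. t ys * ?c xs ys))"
    by (intro has_bochner_integral_sum has_bochner_integral_mult_right
        has_integral_hermite_prod_hermite_prod)
  moreover have "(\<Sum>xs | length xs = m. s xs * (\<Sum>ys | length ys = k. t ys * ?c xs ys))
      = (if m = k then fact m * tensor_inner m s t else 0)"
  proof (cases "m = k")
    case True
    then show ?thesis
      by (simp add: sum_mset_eq_fact[OF t] tensor_inner_def sum_distrib_left mult_ac)
  next
    case False
    have "t ys * ?c xs ys = 0" if "length xs = m" "length ys = k" for xs ys
      using that False by (auto dest: mset_eq_length)
    with False show ?thesis by (auto intro!: sum.neutral)
  qed
  moreover have "wiener_ito m s w * wiener_ito k t w = (\<Sum>xs | length xs = m. s xs *
      (\<Sum>ys | length ys = k. t ys * (hermite_prod xs w * hermite_prod ys w)))" for w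
    unfolding wiener_ito_hermite_prod sum_product
    unfolding sum_distrib_left
    by (intro sum.cong refl) (simp only: mult_ac)
  ultimately show ?thesis by simp
qed

lemma has_integral_sum_wiener_ito_power2:
  assumes t: "\<And>m. t m \<in> sym_tensors m"
  shows "has_bochner_integral gauss (\<lambda>w. (\<Sum>m<N. wiener_ito m (t m) w)\<^sup>2)
    (\<Sum>m<N. fact m * tensor_inner m (t m) (t m))"
proof -
  have "has_bochner_integral gauss
      (\<lambda>w. \<Sum>m<N. \<Sum>k<N. wiener_ito m (t m) w * wiener_ito k (t k) w)
      (\<Sum>m<N. \<Sum>k<N. if m = k then fact m * tensor_inner m (t m) (t k) else 0)"
    by (intro has_bochner_integral_sum has_integral_wiener_ito_wiener_ito t)
  moreover have "(\<Sum>m<N. \<Sum>k<N. if m = k then fact m * tensor_inner m (t m) (t k) else 0)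
      = (\<Sum>m<N. fact m * tensor_inner m (t m) (t m))"
    by (intro sum.cong refl) (simp add: if_distrib)
  ultimately show ?thesis
    by (simp add: power2_eq_square sum_product)
qed

text \<open>The factor \<open>1 / m!\<close> makes this the order-\<open>m\<close> chaos kernel of \<open>wick_exp h\<close>.\<close>

definition wick_exp_kernel :: "nat \<Rightarrow> real ^ 'n \<Rightarrow> 'n tensor" where
  "wick_exp_kernel m h xs = (if length xs = m then coord_prod h xs / fact m else 0)"

lemma wick_exp_kernel_sym: "wick_exp_kernel m h \<in> sym_tensors m"
  by (rule sym_tensorsI) (auto simp: wick_exp_kernel_def coord_prod_permute_list)

text \<open>Expanding the square, the mixed term and the square of the partial sum give the same
  partial sum of the exponential series at |h|^2, so its tail is left. An exact value, and not only
  the limit, is needed because the remainder will be integrated over \<open>h\<close>.\<close>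

lemma has_integral_wick_exp_remainder:
  fixes h :: "real ^ 'n::finite"
  shows "has_bochner_integral gauss
     (\<lambda>w. (wick_exp h w - (\<Sum>m<N. wiener_ito m (wick_exp_kernel m h) w))\<^sup>2)
     (exp ((norm h)\<^sup>2) - (\<Sum>m<N. ((norm h)\<^sup>2) ^ m / fact m))"
proof -
  let ?S = "\<Sum>m<N. ((norm h)\<^sup>2) ^ m / fact m"
  have 1: "tensor_inner m (wick_exp_kernel m h) (coord_prod h) = ((norm h)\<^sup>2) ^ m / fact m" for m
    using sum_coord_prod_mult[of h h m]
    by (simp add: tensor_inner_def wick_exp_kernel_def power2_norm_eq_inner flip: sum_divide_distrib)
  have 2: "fact m * tensor_inner m (wick_exp_kernel m h) (wick_exp_kernel m h) = ((norm h)\<^sup>2) ^ m / fact m" for m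
    using sum_coord_prod_mult[of h h m]
    by (simp add: tensor_inner_def wick_exp_kernel_def power2_norm_eq_inner flip: sum_divide_distrib)
  note E = has_integral_wick_exp_power2[of h]
  have EI: "has_bochner_integral gauss (\<lambda>w. wick_exp h w * wiener_ito m (wick_exp_kernel m h) w)
      (((norm h)\<^sup>2) ^ m / fact m)" for m
    using has_integral_wick_exp_wiener_ito[of h m "wick_exp_kernel m h"] by (simp add: 1)
  have M: "has_bochner_integral gauss (\<lambda>w. 2 * (\<Sum>m<N. wick_exp h w * wiener_ito m (wick_exp_kernel m h) w)) (2 * ?S)"
    by (intro has_bochner_integral_mult_right has_bochner_integral_sum EI)
  have Q: "has_bochner_integral gauss (\<lambda>w. (\<Sum>m<N. wiener_ito m (wick_exp_kernel m h) w)\<^sup>2) ?S"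
    using has_integral_sum_wiener_ito_power2[of "\<lambda>m. wick_exp_kernel m h" N, OF wick_exp_kernel_sym]
    by (simp add: 2)
  have "(a - b)\<^sup>2 = a\<^sup>2 - 2 * (a * b) + b\<^sup>2" for a b :: real
    by (simp add: power2_diff)
  then show ?thesis
    using has_bochner_integral_add[OF has_bochner_integral_diff[OF E M] Q]
    by (simp flip: sum_distrib_left)
qed

section \<open>Uniqueness of the chaos expansion\<close>

lemma integrable_mult_L2:
  fixes f g :: "'a \<Rightarrow> real"
  assumes [measurable]: "f \<in> borel_measurable M" "g \<in> borel_measurable M"
    and "integrable M (\<lambda>x. (f x)\<^sup>2)" "integrable M (\<lambda>x. (g x)\<^sup>2)"
  shows "integrable M (\<lambda>x. f x * g x)"
proof (rule Bochner_Integration.integrable_bound)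
  show "integrable M (\<lambda>x. (f x)\<^sup>2 + (g x)\<^sup>2)"
    using assms by simp
  have "\<bar>a * b\<bar> \<le> a\<^sup>2 + b\<^sup>2" for a b :: real
  proof -
    have "0 \<le> \<bar>a\<bar> * \<bar>b\<bar>" by simp
    then show ?thesis
      using sum_squares_bound[of "\<bar>a\<bar>" "\<bar>b\<bar>"] unfolding abs_mult power2_abs by linarith
  qed
  then show "AE x in M. norm (f x * g x) \<le> norm ((f x)\<^sup>2 + (g x)\<^sup>2)"
    by simp
qed simp

lemma integrable_diff_L2:
  fixes f g :: "'a \<Rightarrow> real"
  assumes "f \<in> borel_measurable M" "g \<in> borel_measurable M"
    and "integrable M (\<lambda>x. (f x)\<^sup>2)" "integrable M (\<lambda>x. (g x)\<^sup>2)"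
  shows "integrable M (\<lambda>x. (f x - g x)\<^sup>2)"
  using integrable_mult_L2[OF assms] assms by (simp add: power2_diff mult.assoc)

lemma integral_mult_power2_le:
  fixes f g :: "'a \<Rightarrow> real"
  assumes [measurable]: "f \<in> borel_measurable M" "g \<in> borel_measurable M"
    and f: "integrable M (\<lambda>x. (f x)\<^sup>2)" and g: "integrable M (\<lambda>x. (g x)\<^sup>2)"
  shows "(LINT x|M. f x * g x)\<^sup>2 \<le> (LINT x|M. (f x)\<^sup>2) * (LINT x|M. (g x)\<^sup>2)"
proof -
  let ?A = "LINT x|M. (f x)\<^sup>2" and ?B = "LINT x|M. f x * g x" and ?C = "LINT x|M. (g x)\<^sup>2"
  note fg = integrable_mult_L2[OF assms]
  have *: "0 \<le> s\<^sup>2 * ?A - 2 * s * t * ?B + t\<^sup>2 * ?C" for s t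
  proof -
    have "0 \<le> (LINT x|M. (s * f x - t * g x)\<^sup>2)"
      by simp
    also have "\<dots> = (LINT x|M. s\<^sup>2 * (f x)\<^sup>2 - 2 * s * t * (f x * g x) + t\<^sup>2 * (g x)\<^sup>2)"
      by (rule Bochner_Integration.integral_cong) (auto simp: power2_eq_square algebra_simps)
    finally show ?thesis using f g fg by simp
  qed
  have C0: "0 \<le> ?C" by simp
  show ?thesis
  proof (cases "?C = 0")
    case True
    have "?B = 0"
    proof (rule ccontr)
      assume "?B \<noteq> 0"
      \<comment> \<open>At s = 1 and t = (A + 1) / (2 B) the quadratic form takes the value A - (A +
        1) = -1.\<close>
      then show False
        using *[of 1 "(?A + 1) / (2 * ?B)"] True by simp
    qed
    with True show ?thesis by simp
  next
    case False
    \<comment> \<open>The minimizing direction s : t = C : B of the quadratic form.\<close>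
    then have "0 \<le> (?A * ?C - ?B\<^sup>2) * ?C"
      using *[of ?C ?B] by (simp add: power2_eq_square algebra_simps)
    then show ?thesis
      using False C0 by (simp add: zero_le_mult_iff)
  qed
qed

section \<open>The kernels are determined by the function\<close>

lemma Lspace_2_iff: "f \<in> Lspace 2 \<longleftrightarrow> f \<in> borel_measurable borel \<and> integrable gauss (\<lambda>w. (f w)\<^sup>2)"
  by (simp add: Lspace_def powr_numeral cong: measurable_cong_sets)

lemma tensor_inner_self_nonneg: "0 \<le> tensor_inner m t t"
  by (simp add: tensor_inner_def sum_nonneg)

lemma integrable_wiener_ito_sum_power2:
  assumes "\<And>m. t m \<in> sym_tensors m"
  shows "integrable gauss (\<lambda>w. (\<Sum>m<N. wiener_ito m (t m) w)\<^sup>2)"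
  using has_integral_sum_wiener_ito_power2[of t, OF assms] by (simp add: has_bochner_integral_iff)

lemma has_chaos_expansionD:
  assumes "has_chaos_expansion f u"
  shows "f \<in> borel_measurable borel" "integrable gauss (\<lambda>w. (f w)\<^sup>2)" "u m \<in> sym_tensors m"
    and "integrable gauss (\<lambda>w. (f w - (\<Sum>m<N. wiener_ito m (u m) w))\<^sup>2)"
    and "(\<lambda>N. LINT w|gauss. (f w - (\<Sum>m<N. wiener_ito m (u m) w))\<^sup>2) \<longlonglongrightarrow> 0"
proof -
  show 1: "f \<in> borel_measurable borel" "integrable gauss (\<lambda>w. (f w)\<^sup>2)"
    and u: "u m \<in> sym_tensors m" for m
    using assms by (auto simp: has_chaos_expansion_def Lspace_2_iff)
  show "integrable gauss (\<lambda>w. (f w - (\<Sum>m<N. wiener_ito m (u m) w))\<^sup>2)"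
    by (intro integrable_diff_L2 integrable_wiener_ito_sum_power2 1 u)
       (use 1 in \<open>simp_all cong: measurable_cong_sets\<close>)
  show "(\<lambda>N. LINT w|gauss. (f w - (\<Sum>m<N. wiener_ito m (u m) w))\<^sup>2) \<longlonglongrightarrow> 0"
    using assms by (simp add: has_chaos_expansion_def)
qed

text \<open>By the isometry, the weighted square norms of the kernel differences add up to the
  square integral of the difference of two partial sums. Both of these approximate \<open>f\<close>,
  so the sum is bounded by quantities tending to 0, while it never decreases in
  \<open>N\<close>.\<close>

lemma has_chaos_expansion_unique:
  assumes u: "has_chaos_expansion f u" and v: "has_chaos_expansion f v"
  shows "u = v"
proof -
  let ?d = "\<lambda>m xs. u m xs - v m xs"
  let ?S = "\<lambda>u N w. \<Sum>m<N. wiener_ito m (u m) w"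
  have d: "?d m \<in> sym_tensors m" for m
    by (intro sym_tensors_diff has_chaos_expansionD(3)[OF u] has_chaos_expansionD(3)[OF v])
  note iu = has_chaos_expansionD(4)[OF u] and iv = has_chaos_expansionD(4)[OF v]
  have bound: "(\<Sum>m<N. fact m * tensor_inner m (?d m) (?d m))
      \<le> 2 * (LINT w|gauss. (f w - ?S u N w)\<^sup>2) + 2 * (LINT w|gauss. (f w - ?S v N w)\<^sup>2)" for N
  proof -
    have "(\<Sum>m<N. fact m * tensor_inner m (?d m) (?d m)) = (LINT w|gauss. (?S ?d N w)\<^sup>2)"
      using has_integral_sum_wiener_ito_power2[of ?d, OF d] by (simp add: has_bochner_integral_iff)
    also have "\<dots> \<le> (LINT w|gauss. 2 * (f w - ?S u N w)\<^sup>2 + 2 * (f w - ?S v N w)\<^sup>2)"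
    proof (rule integral_mono)
      have "(a - b)\<^sup>2 \<le> 2 * (c - a)\<^sup>2 + 2 * (c - b)\<^sup>2" for a b c :: real
        using zero_le_power2[of "2 * c - a - b"] by (simp add: power2_eq_square algebra_simps)
      then show "(?S ?d N w)\<^sup>2 \<le> 2 * (f w - ?S u N w)\<^sup>2 + 2 * (f w - ?S v N w)\<^sup>2" for w
        by (simp add: wiener_ito_diff sum_subtractf)
    qed (use iu iv integrable_wiener_ito_sum_power2[of ?d, OF d] in auto)
    also have "\<dots> = 2 * (LINT w|gauss. (f w - ?S u N w)\<^sup>2) + 2 * (LINT w|gauss. (f w - ?S v N w)\<^sup>2)"
      using iu iv by simp
    finally show ?thesis .
  qed
  have lim: "(\<lambda>N. 2 * (LINT w|gauss. (f w - ?S u N w)\<^sup>2) + 2 * (LINT w|gauss. (f w - ?S v N w)\<^sup>2))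
      \<longlonglongrightarrow> 2 * 0 + 2 * 0"
    by (intro tendsto_intros has_chaos_expansionD(5)[OF u] has_chaos_expansionD(5)[OF v])
  have zero: "tensor_inner m (?d m) (?d m) = 0" for m
  proof -
    have "fact m * tensor_inner m (?d m) (?d m) \<le> 2 * 0 + 2 * 0"
    proof (rule LIMSEQ_le_const[OF lim], intro exI allI impI)
      fix N assume "Suc m \<le> N"
      then have "fact m * tensor_inner m (?d m) (?d m) \<le> (\<Sum>m<N. fact m * tensor_inner m (?d m) (?d m))"
        by (intro member_le_sum) (auto simp: tensor_inner_self_nonneg)
      also note bound[of N]
      finally show "fact m * tensor_inner m (?d m) (?d m) \<le> 2 * (LINT w|gauss. (f w - ?S u N w)\<^sup>2)
          + 2 * (LINT w|gauss. (f w - ?S v N w)\<^sup>2)" .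
    qed
    then show ?thesis
      using tensor_inner_self_nonneg[of m "?d m"] by (smt (verit) mult_pos_pos fact_gt_zero)
  qed
  have "?d m xs = 0" for m xs
  proof (cases "length xs = m")
    case True
    have "(?d m xs)\<^sup>2 \<le> tensor_inner m (?d m) (?d m)"
      unfolding tensor_inner_def power2_eq_square
      by (rule member_le_sum[of _ _ "\<lambda>xs. ?d m xs * ?d m xs"]) (auto simp: True finite_lists_length)
    then show ?thesis using zero by simp
  next
    case False
    then show ?thesis using sym_tensors_0[OF d] by blast
  qed
  then show ?thesis by (auto simp: fun_eq_iff)
qed

lemma chaos_eqI: "has_chaos_expansion f u \<Longrightarrow> chaos f = u"
  unfolding chaos_def by (rule the_equality) (auto intro: has_chaos_expansion_unique)

lemma tendsto_0_if_power2_bounded: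
  fixes a b :: "nat \<Rightarrow> real"
  assumes "\<And>N. (a N)\<^sup>2 \<le> b N" "b \<longlonglongrightarrow> 0"
  shows "a \<longlonglongrightarrow> 0"
proof -
  have "(\<lambda>N. (a N)\<^sup>2) \<longlonglongrightarrow> 0"
    by (rule tendsto_sandwich[of "\<lambda>_. 0" _ _ b]) (use assms in auto)
  then show ?thesis by simp
qed

lemma integrable_mult_wick_exp:
  assumes "f \<in> borel_measurable borel" "integrable gauss (\<lambda>w. (f w)\<^sup>2)"
  shows "integrable gauss (\<lambda>w. f w * wick_exp h w)"
  by (rule integrable_mult_L2)
     (use assms has_integral_wick_exp_power2[of h] in
       \<open>simp_all add: has_bochner_integral_iff cong: measurable_cong_sets\<close>)

text \<open>Integration against \<open>wick_exp h\<close> is continuous in mean square by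
  Cauchy-Schwarz, so it may be applied to the expansion term by term.\<close>

lemma sums_tensor_inner_coord_prod:
  assumes u: "has_chaos_expansion \<phi> u"
  shows "(\<lambda>m. tensor_inner m (u m) (coord_prod h)) sums (LINT w|gauss. \<phi> w * wick_exp h w)"
proof -
  let ?S = "\<lambda>N w. \<Sum>m<N. wiener_ito m (u m) w"
  let ?T = "\<lambda>N. \<Sum>m<N. tensor_inner m (u m) (coord_prod h)"
  let ?I = "LINT w|gauss. \<phi> w * wick_exp h w"
  note [measurable] = has_chaos_expansionD(1)[OF u]
  note i = has_chaos_expansionD(4)[OF u] and E = has_integral_wick_exp_power2[of h]
  note pE = integrable_mult_wick_exp[OF has_chaos_expansionD(1,2)[OF u], of h]
  have T: "has_bochner_integral gauss (\<lambda>w. \<Sum>m<N. wick_exp h w * wiener_ito m (u m) w) (?T N)" for N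
    by (intro has_bochner_integral_sum has_integral_wick_exp_wiener_ito)
  have "(?I - ?T N)\<^sup>2 \<le> (LINT w|gauss. (\<phi> w - ?S N w)\<^sup>2) * exp ((norm h)\<^sup>2)" for N
  proof -
    have "?I - ?T N = (LINT w|gauss. \<phi> w * wick_exp h w - (\<Sum>m<N. wick_exp h w * wiener_ito m (u m) w))"
      using has_bochner_integral_integral_eq[OF T[of N]]
        Bochner_Integration.integral_diff[OF pE integrable.intros[OF T[of N]]]
      by simp
    also have "\<dots> = (LINT w|gauss. (\<phi> w - ?S N w) * wick_exp h w)"
      by (simp add: right_diff_distrib sum_distrib_left mult.commute)
    finally have "?I - ?T N = (LINT w|gauss. (\<phi> w - ?S N w) * wick_exp h w)" .
    moreover have "(LINT w|gauss. (\<phi> w - ?S N w) * wick_exp h w)\<^sup>2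
        \<le> (LINT w|gauss. (\<phi> w - ?S N w)\<^sup>2) * (LINT w|gauss. (wick_exp h w)\<^sup>2)"
      by (rule integral_mult_power2_le) (use i[of N] E in \<open>simp_all add: has_bochner_integral_iff\<close>)
    ultimately show ?thesis
      using has_bochner_integral_integral_eq[OF E] by simp
  qed
  moreover have "(\<lambda>N. (LINT w|gauss. (\<phi> w - ?S N w)\<^sup>2) * exp ((norm h)\<^sup>2)) \<longlonglongrightarrow> 0 * exp ((norm h)\<^sup>2)"
    by (intro tendsto_intros has_chaos_expansionD(5)[OF u])
  ultimately have "(\<lambda>N. ?I - ?T N) \<longlonglongrightarrow> 0"
    unfolding mult_zero_left by (rule tendsto_0_if_power2_bounded)
  from tendsto_diff[OF tendsto_const[of ?I] this] show ?thesis
    by (simp add: sums_def)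
qed

section \<open>Chaos expansion of mixtures of Wick exponentials\<close>

lemma borel_measurable_coord_prod [measurable]: "(\<lambda>h. coord_prod h xs) \<in> borel_measurable borel"
  for xs :: "'n::finite list"
  by (induction xs) auto

lemma borel_measurable_wick_exp2 [measurable (raw)]:
  assumes [measurable]: "f \<in> borel_measurable M" "g \<in> borel_measurable M"
  shows "(\<lambda>x. wick_exp (f x) (g x)) \<in> borel_measurable M"
  unfolding wick_exp_def by measurable

lemma borel_measurable_wick_exp_kernel [measurable]: "(\<lambda>h. wick_exp_kernel m h xs) \<in> borel_measurable borel"
  for xs :: "'n::finite list"
  unfolding wick_exp_kernel_def by measurable

text \<open>Completing the square. The bound is uniform in \<open>h\<close>, so mixtures over
  \<open>h\<close> are finite at every \<open>w\<close>.\<close>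

lemma wick_exp_le: "wick_exp h w \<le> exp ((norm w)\<^sup>2 / 2)"
  using zero_le_power2[of "norm (w - h)"]
  by (simp add: wick_exp_def power2_norm_eq_inner inner_simps inner_commute field_simps)

lemma abs_coord_prod_le: "\<bar>coord_prod h xs\<bar> \<le> norm h ^ length xs"
  for h :: "real ^ 'n::finite"
  by (induction xs) (auto simp: abs_mult intro!: mult_mono component_le_norm_cart)

lemma sums_exp_real: "(\<lambda>n. t ^ n / fact n) sums exp t" for t :: real
  using exp_converges[of t] by (simp add: divide_inverse mult.commute)

lemma power_div_fact_le_exp:
  fixes t :: real
  assumes "0 \<le> t"
  shows "t ^ m / fact m \<le> exp t"
proof -
  have "(\<Sum>n\<in>{m}. t ^ n / fact n) \<le> (\<Sum>n. t ^ n / fact n)"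
    by (rule sum_le_suminf[OF sums_summable[OF sums_exp_real]]) (use assms in auto)
  then show ?thesis
    unfolding sums_unique[OF sums_exp_real, symmetric] by simp
qed

text \<open>Brings the kernels of all orders under one weight exp (|h|^2 / 2), by way of |h| \<le>
  1/2 + |h|^2 / 2.\<close>

lemma norm_power_div_fact_le: "norm h ^ m / fact m \<le> exp (1 / 2) * exp ((norm h)\<^sup>2 / 2)"
proof -
  have "norm h ^ m / fact m \<le> exp (norm h)"
    by (rule power_div_fact_le_exp) simp
  also have "norm h \<le> 1 / 2 + (norm h)\<^sup>2 / 2"
    using zero_le_power2[of "norm h - 1"] by (simp add: power2_eq_square algebra_simps)
  finally show ?thesis
    by (simp add: exp_add)
qed

lemma abs_wick_exp_kernel_le: "\<bar>wick_exp_kernel m h xs\<bar> \<le> exp (1 / 2) * exp ((norm h)\<^sup>2 / 2)"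
  for h :: "real ^ 'n::finite"
  using norm_power_div_fact_le[of h m] abs_coord_prod_le[of h xs]
  by (auto simp: wick_exp_kernel_def intro: order_trans[OF divide_right_mono])

definition exp_tail :: "nat \<Rightarrow> real \<Rightarrow> real" where
  "exp_tail N t = exp t - (\<Sum>m<N. t ^ m / fact m)"

lemma exp_tail_bounds: "0 \<le> t \<Longrightarrow> 0 \<le> exp_tail N t" "0 \<le> t \<Longrightarrow> exp_tail N t \<le> exp t"
  and exp_tail_tendsto: "(\<lambda>N. exp_tail N t) \<longlonglongrightarrow> 0"
proof -
  show "exp_tail N t \<le> exp t" if "0 \<le> t"
    using that by (simp add: exp_tail_def sum_nonneg)
  show "0 \<le> exp_tail N t" if "0 \<le> t"
  proof -
    have "(\<Sum>n<N. t ^ n / fact n) \<le> (\<Sum>n. t ^ n / fact n)"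
      by (rule sum_le_suminf[OF sums_summable[OF sums_exp_real]]) (use that in auto)
    then show ?thesis
      unfolding sums_unique[OF sums_exp_real, symmetric] by (simp add: exp_tail_def)
  qed
  have "(\<lambda>N. exp t - (\<Sum>m<N. t ^ m / fact m)) \<longlonglongrightarrow> exp t - exp t"
    using sums_exp_real[of t] unfolding sums_def by (intro tendsto_intros)
  then show "(\<lambda>N. exp_tail N t) \<longlonglongrightarrow> 0"
    by (simp add: exp_tail_def)
qed

text \<open>The weight 1 gives \<open>xi\<close>, the weight \<open>y $ k\<close> its partial
  derivatives. Since exp (|y|^2 / 2) is the mean-square norm of \<open>wick_exp y\<close>, the last
  assumption says that the mixed family has finite total norm, which is what makes the mixture
  square integrable.\<close>

locale weighted_prob = prob_space \<nu> for \<nu> :: "(real ^ 'n::finite) measure" +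
  fixes a :: "real ^ 'n \<Rightarrow> real"
  assumes sets_nu [measurable_cong]: "sets \<nu> = sets borel"
    and a_measurable [measurable]: "a \<in> borel_measurable borel"
    and integrable_weight: "integrable \<nu> (\<lambda>y. \<bar>a y\<bar> * exp ((norm y)\<^sup>2 / 2))"
begin

definition xi_weighted :: "real ^ 'n \<Rightarrow> real" where
  "xi_weighted w = (LINT y|\<nu>. a y * wick_exp y w)"

definition mean_kernel :: "nat \<Rightarrow> 'n tensor" where
  "mean_kernel m xs = (LINT y|\<nu>. a y * wick_exp_kernel m y xs)"

lemma integrable_weight_mult:
  assumes [measurable]: "g \<in> borel_measurable borel"
    and le: "\<And>y. \<bar>g y\<bar> \<le> C * exp ((norm y)\<^sup>2 / 2)"
  shows "integrable \<nu> (\<lambda>y. a y * g y)"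
proof (rule Bochner_Integration.integrable_bound)
  show "integrable \<nu> (\<lambda>y. C * (\<bar>a y\<bar> * exp ((norm y)\<^sup>2 / 2)))"
    using integrable_weight by simp
  have "\<bar>a y * g y\<bar> \<le> \<bar>C * (\<bar>a y\<bar> * exp ((norm y)\<^sup>2 / 2))\<bar>" for y
  proof -
    have "\<bar>a y * g y\<bar> \<le> C * (\<bar>a y\<bar> * exp ((norm y)\<^sup>2 / 2))"
      using mult_left_mono[OF le[of y], of "\<bar>a y\<bar>"] by (simp add: abs_mult mult.left_commute)
    then show ?thesis by (rule order_trans[OF _ abs_ge_self])
  qed
  then show "AE y in \<nu>. norm (a y * g y) \<le> norm (C * (\<bar>a y\<bar> * exp ((norm y)\<^sup>2 / 2)))"
    by simp
qed simp

lemma integrable_weight_wick_exp: "integrable \<nu> (\<lambda>y. a y * wick_exp y w)"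
proof (rule integrable_weight_mult)
  show "\<bar>wick_exp y w\<bar> \<le> exp ((norm w)\<^sup>2 / 2) * exp ((norm y)\<^sup>2 / 2)" for y
  proof -
    have "wick_exp y w * 1 \<le> exp ((norm w)\<^sup>2 / 2) * exp ((norm y)\<^sup>2 / 2)"
      by (intro mult_mono wick_exp_le) auto
    then show ?thesis by (simp add: less_imp_le)
  qed
qed simp

lemma integrable_weight_wick_exp_kernel: "integrable \<nu> (\<lambda>y. a y * wick_exp_kernel m y xs)"
  by (rule integrable_weight_mult[OF _ abs_wick_exp_kernel_le]) simp

lemma borel_measurable_xi_weighted: "xi_weighted \<in> borel_measurable borel"
  unfolding xi_weighted_def[abs_def] by measurable

lemma mean_kernel_sym: "mean_kernel m \<in> sym_tensors m"
proof (rule sym_tensorsI)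
  show "mean_kernel m xs = 0" if "length xs \<noteq> m" for xs
    using that by (simp add: mean_kernel_def wick_exp_kernel_def)
  show "mean_kernel m (permute_list \<sigma> xs) = mean_kernel m xs" if "\<sigma> permutes {..<length xs}" for \<sigma> xs
  proof -
    have "wick_exp_kernel m y (permute_list \<sigma> xs) = wick_exp_kernel m y xs" for y :: "real ^ 'n"
      using wick_exp_kernel_sym[of m y] that unfolding sym_tensors_def by blast
    then show ?thesis by (simp add: mean_kernel_def)
  qed
qed

definition remainder :: "nat \<Rightarrow> real ^ 'n \<Rightarrow> real ^ 'n \<Rightarrow> real" where
  "remainder N w y = wick_exp y w - (\<Sum>m<N. wiener_ito m (wick_exp_kernel m y) w)"

lemma borel_measurable_remainder [measurable]:
  "(\<lambda>(w, y). remainder N w y) \<in> borel_measurable (borel \<Otimes>\<^sub>M borel)"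
  unfolding remainder_def wiener_ito_hermite_prod case_prod_beta by measurable

lemma integrable_weight_wiener_ito: "integrable \<nu> (\<lambda>y. a y * wiener_ito m (wick_exp_kernel m y) w)"
  and integral_weight_wiener_ito:
    "(LINT y|\<nu>. a y * wiener_ito m (wick_exp_kernel m y) w) = wiener_ito m (mean_kernel m) w"
proof -
  have eq: "a y * wiener_ito m (wick_exp_kernel m y) w
      = (\<Sum>xs | length xs = m. (a y * wick_exp_kernel m y xs) * hermite_prod xs w)" for y
    by (simp add: wiener_ito_hermite_prod sum_distrib_left mult.assoc)
  show "integrable \<nu> (\<lambda>y. a y * wiener_ito m (wick_exp_kernel m y) w)"
    unfolding eq
    by (intro Bochner_Integration.integrable_sum integrable_mult_left integrable_weight_wick_exp_kernel)
  show "(LINT y|\<nu>. a y * wiener_ito m (wick_exp_kernel m y) w) = wiener_ito m (mean_kernel m) w"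
    unfolding eq
    by (subst Bochner_Integration.integral_sum)
       (auto simp: wiener_ito_hermite_prod mean_kernel_def integrable_weight_wick_exp_kernel)
qed

lemma xi_weighted_remainder:
  "xi_weighted w - (\<Sum>m<N. wiener_ito m (mean_kernel m) w) = (LINT y|\<nu>. a y * remainder N w y)"
  and integrable_weight_remainder: "integrable \<nu> (\<lambda>y. a y * remainder N w y)"
proof -
  have eq: "a y * remainder N w y = a y * wick_exp y w - (\<Sum>m<N. a y * wiener_ito m (wick_exp_kernel m y) w)" for y
    by (simp add: remainder_def right_diff_distrib sum_distrib_left)
  have i: "integrable \<nu> (\<lambda>y. \<Sum>m<N. a y * wiener_ito m (wick_exp_kernel m y) w)"
    by (intro Bochner_Integration.integrable_sum integrable_weight_wiener_ito)
  show "integrable \<nu> (\<lambda>y. a y * remainder N w y)"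
    unfolding eq by (intro Bochner_Integration.integrable_diff integrable_weight_wick_exp i)
  show "xi_weighted w - (\<Sum>m<N. wiener_ito m (mean_kernel m) w) = (LINT y|\<nu>. a y * remainder N w y)"
    unfolding eq Bochner_Integration.integral_diff[OF integrable_weight_wick_exp i]
    by (simp add: xi_weighted_def Bochner_Integration.integral_sum integrable_weight_wiener_ito
        integral_weight_wiener_ito)
qed

section \<open>Mean-square error of the mixed expansion\<close>

definition weight_mass :: real where
  "weight_mass = (LINT y|\<nu>. \<bar>a y\<bar> * exp ((norm y)\<^sup>2 / 2))"

definition tail_mass :: "nat \<Rightarrow> real" where
  "tail_mass N = (LINT y|\<nu>. \<bar>a y\<bar> * exp (- (norm y)\<^sup>2 / 2) * exp_tail N ((norm y)\<^sup>2))"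

lemma weight_mass_nonneg: "0 \<le> weight_mass"
  by (simp add: weight_mass_def)

lemma borel_measurable_exp_tail [measurable]: "exp_tail N \<in> borel_measurable borel"
  unfolding exp_tail_def[abs_def] by measurable

lemma tail_weight_le:
  "\<bar>\<bar>a y\<bar> * exp (- (norm y)\<^sup>2 / 2) * exp_tail N ((norm y)\<^sup>2)\<bar> \<le> \<bar>a y\<bar> * exp ((norm y)\<^sup>2 / 2)"
proof -
  have "\<bar>a y\<bar> * exp (- (norm y)\<^sup>2 / 2) * exp_tail N ((norm y)\<^sup>2)
      \<le> \<bar>a y\<bar> * exp (- (norm y)\<^sup>2 / 2) * exp ((norm y)\<^sup>2)"
    by (intro mult_left_mono exp_tail_bounds) auto
  also have "\<dots> = \<bar>a y\<bar> * exp ((norm y)\<^sup>2 / 2)"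
    by (simp add: mult.assoc mult_exp_exp)
  finally show ?thesis
    by (simp add: abs_mult exp_tail_bounds)
qed

lemma integrable_tail_weight:
  "integrable \<nu> (\<lambda>y. \<bar>a y\<bar> * exp (- (norm y)\<^sup>2 / 2) * exp_tail N ((norm y)\<^sup>2))"
  by (rule Bochner_Integration.integrable_bound[OF integrable_weight]) (use tail_weight_le in auto)

lemma tail_mass_nonneg: "0 \<le> tail_mass N"
  by (auto simp: tail_mass_def exp_tail_bounds)

lemma tail_mass_tendsto: "tail_mass \<longlonglongrightarrow> 0"
proof -
  have "(\<lambda>N. tail_mass N) \<longlonglongrightarrow> (LINT y|\<nu>. 0)"
    unfolding tail_mass_def
  proof (rule integral_dominated_convergence[OF _ _ integrable_weight])
    have "(\<lambda>N. \<bar>a y\<bar> * exp (- (norm y)\<^sup>2 / 2) * exp_tail N ((norm y)\<^sup>2)) \<longlonglongrightarrow>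
        \<bar>a y\<bar> * exp (- (norm y)\<^sup>2 / 2) * 0" for y
      by (intro tendsto_intros exp_tail_tendsto)
    then show "AE y in \<nu>. (\<lambda>N. \<bar>a y\<bar> * exp (- (norm y)\<^sup>2 / 2) * exp_tail N ((norm y)\<^sup>2)) \<longlonglongrightarrow> 0"
      by simp
  qed (use tail_weight_le in auto)
  then show ?thesis by simp
qed

lemma nn_integral_remainder:
  "(\<integral>\<^sup>+w. ennreal ((remainder N w y)\<^sup>2) \<partial>gauss) = ennreal (exp_tail N ((norm y)\<^sup>2))"
  using has_integral_wick_exp_remainder[of y N]
  by (subst nn_integral_eq_integral) (auto simp: has_bochner_integral_iff remainder_def exp_tail_def)

text \<open>The weights \<open>exp (\<plusminus> |y|\<^sup>2 / 2)\<close> balance the square integral \<open>exp (|y|\<^sup>2)\<close> of \<open>wick_exp y\<close>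
  over the Gaussian measure, so that both Cauchy-Schwarz factors see \<open>exp (|y|\<^sup>2 / 2)\<close>.\<close>

lemma nn_integral_expansion_error:
  "(\<integral>\<^sup>+w. ennreal ((xi_weighted w - (\<Sum>m<N. wiener_ito m (mean_kernel m) w))\<^sup>2) \<partial>gauss)
     \<le> ennreal (weight_mass * tail_mass N)"
proof -
  let ?p = "\<lambda>y. sqrt (\<bar>a y\<bar> * exp ((norm y)\<^sup>2 / 2))"
  let ?q = "\<lambda>w y. sqrt (\<bar>a y\<bar> * exp (- (norm y)\<^sup>2 / 2)) * \<bar>remainder N w y\<bar>"
  interpret gauss: prob_space "gauss :: (real ^ 'n) measure" by (rule prob_space_gauss)
  interpret pair_sigma_finite "gauss :: (real ^ 'n) measure" \<nu> ..
  have pq: "?p y * ?q w y = \<bar>a y * remainder N w y\<bar>" for w y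
  proof -
    have "?p y * ?q w y = sqrt ((\<bar>a y\<bar> * exp ((norm y)\<^sup>2 / 2)) * (\<bar>a y\<bar> * exp (- (norm y)\<^sup>2 / 2)))
        * \<bar>remainder N w y\<bar>"
      by (simp add: real_sqrt_mult mult.assoc)
    also have "(\<bar>a y\<bar> * exp ((norm y)\<^sup>2 / 2)) * (\<bar>a y\<bar> * exp (- (norm y)\<^sup>2 / 2)) = \<bar>a y\<bar>\<^sup>2"
      by (simp add: mult_exp_exp power2_eq_square mult_ac)
    finally show ?thesis by (simp add: abs_mult)
  qed
  have ennreal_pq: "ennreal (?p y) * ennreal (?q w y) = ennreal \<bar>a y * remainder N w y\<bar>" for w y
    unfolding pq[symmetric] by (rule ennreal_mult[symmetric]) simp_all
  have "ennreal ((xi_weighted w - (\<Sum>m<N. wiener_ito m (mean_kernel m) w))\<^sup>2)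
      \<le> ennreal weight_mass * (\<integral>\<^sup>+y. ennreal (?q w y) ^ 2 \<partial>\<nu>)" for w
  proof -
    have "ennreal \<bar>LINT y|\<nu>. a y * remainder N w y\<bar> \<le> (\<integral>\<^sup>+y. ennreal (?p y) * ennreal (?q w y) \<partial>\<nu>)"
      using integral_norm_bound_ennreal[OF integrable_weight_remainder[of N w]]
      unfolding ennreal_pq by simp
    then have "(ennreal \<bar>LINT y|\<nu>. a y * remainder N w y\<bar>)\<^sup>2
        \<le> (\<integral>\<^sup>+y. ennreal (?p y) * ennreal (?q w y) \<partial>\<nu>)\<^sup>2"
      by (rule power_mono) simp
    also have "\<dots> \<le> (\<integral>\<^sup>+y. ennreal (?p y) ^ 2 \<partial>\<nu>) * (\<integral>\<^sup>+y. ennreal (?q w y) ^ 2 \<partial>\<nu>)"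
      by (rule Cauchy_Schwarz_nn_integral) measurable
    also have "(\<integral>\<^sup>+y. ennreal (?p y) ^ 2 \<partial>\<nu>) = ennreal weight_mass"
      unfolding weight_mass_def
      by (subst nn_integral_eq_integral[symmetric]) (auto simp: ennreal_power integrable_weight)
    finally show ?thesis
      by (simp add: xi_weighted_remainder ennreal_power)
  qed
  then have "(\<integral>\<^sup>+w. ennreal ((xi_weighted w - (\<Sum>m<N. wiener_ito m (mean_kernel m) w))\<^sup>2) \<partial>gauss)
      \<le> (\<integral>\<^sup>+w. ennreal weight_mass * (\<integral>\<^sup>+y. ennreal (?q w y) ^ 2 \<partial>\<nu>) \<partial>gauss)"
    by (intro nn_integral_mono) auto
  also have "\<dots> = ennreal weight_mass * (\<integral>\<^sup>+w. (\<integral>\<^sup>+y. ennreal (?q w y) ^ 2 \<partial>\<nu>) \<partial>gauss)"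
    by (rule nn_integral_cmult) measurable
  also have "(\<integral>\<^sup>+w. (\<integral>\<^sup>+y. ennreal (?q w y) ^ 2 \<partial>\<nu>) \<partial>gauss) = (\<integral>\<^sup>+y. (\<integral>\<^sup>+w. ennreal (?q w y) ^ 2 \<partial>gauss) \<partial>\<nu>)"
    by (rule Fubini'[symmetric]) measurable
  also have "\<dots> = (\<integral>\<^sup>+y. ennreal (\<bar>a y\<bar> * exp (- (norm y)\<^sup>2 / 2) * exp_tail N ((norm y)\<^sup>2)) \<partial>\<nu>)"
  proof (rule nn_integral_cong)
    fix y
    have "ennreal (?q w y) ^ 2 = ennreal (\<bar>a y\<bar> * exp (- (norm y)\<^sup>2 / 2)) * ennreal ((remainder N w y)\<^sup>2)" for w
      by (simp add: ennreal_power power_mult_distrib ennreal_mult)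
    then show "(\<integral>\<^sup>+w. ennreal (?q w y) ^ 2 \<partial>gauss)
        = ennreal (\<bar>a y\<bar> * exp (- (norm y)\<^sup>2 / 2) * exp_tail N ((norm y)\<^sup>2))"
      by (simp add: nn_integral_cmult nn_integral_remainder ennreal_mult exp_tail_bounds)
  qed
  also have "\<dots> = ennreal (tail_mass N)"
    unfolding tail_mass_def
    by (intro nn_integral_eq_integral integrable_tail_weight) (simp add: exp_tail_bounds)
  finally show ?thesis
    by (simp add: ennreal_mult weight_mass_nonneg tail_mass_nonneg)
qed

lemma xi_weighted_Lspace_2: "xi_weighted \<in> Lspace 2"
proof -
  note [measurable] = borel_measurable_xi_weighted
  \<comment> \<open>For \<open>N = 0\<close> the partial sum is empty and the expansion error is the
    square of \<open>xi_weighted\<close> itself.\<close>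
  have "(\<integral>\<^sup>+w. ennreal ((xi_weighted w)\<^sup>2) \<partial>gauss) < \<infinity>"
    using nn_integral_expansion_error[of 0] by (simp add: le_less_trans)
  then show ?thesis
    by (auto simp: Lspace_2_iff integrable_iff_bounded)
qed

theorem has_chaos_expansion_xi_weighted: "has_chaos_expansion xi_weighted mean_kernel"
  unfolding has_chaos_expansion_def
proof (intro conjI allI xi_weighted_Lspace_2 mean_kernel_sym)
  note [measurable] = borel_measurable_xi_weighted
  let ?D = "\<lambda>N w. (xi_weighted w - (\<Sum>m<N. wiener_ito m (mean_kernel m) w))\<^sup>2"
  have le: "(LINT w|gauss. ?D N w) \<le> weight_mass * tail_mass N" for N
  proof (rule integral_real_bounded)
    show "(\<integral>\<^sup>+w. ennreal (?D N w) \<partial>gauss) \<le> ennreal (weight_mass * tail_mass N)"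
      by (rule nn_integral_expansion_error)
  qed (simp add: weight_mass_nonneg tail_mass_nonneg)
  have "(\<lambda>N. weight_mass * tail_mass N) \<longlonglongrightarrow> weight_mass * 0"
    by (intro tendsto_intros tail_mass_tendsto)
  then show "(\<lambda>N. LINT w|gauss. ?D N w) \<longlonglongrightarrow> 0"
    by (intro tendsto_sandwich[of "\<lambda>_. 0" "\<lambda>N. LINT w|gauss. ?D N w" _ "\<lambda>N. weight_mass * tail_mass N"])
       (auto simp: le)
qed

lemma chaos_xi_weighted: "chaos xi_weighted = mean_kernel"
  by (rule chaos_eqI[OF has_chaos_expansion_xi_weighted])

end

section \<open>Symmetrized products of tensor powers\<close>

lemma ex_permutes_image_eq:
  assumes "finite A" "S \<subseteq> A" "T \<subseteq> A" "card S = card T"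
  obtains \<tau> where "\<tau> permutes A" "\<tau> ` S = T"
proof -
  have fin: "finite S" "finite T" "finite (A - S)" "finite (A - T)"
    using assms by (auto intro: finite_subset)
  obtain f where f: "bij_betw f S T"
    using finite_same_card_bij[OF fin(1,2) assms(4)] by blast
  have "card (A - S) = card (A - T)"
    using assms fin by (simp add: card_Diff_subset)
  then obtain g where g: "bij_betw g (A - S) (A - T)"
    using finite_same_card_bij[OF fin(3,4)] by blast
  define \<tau> where "\<tau> x = (if x \<in> S then f x else if x \<in> A then g x else x)" for x
  have fS: "bij_betw \<tau> S T"
    using f by (rule bij_betw_cong[THEN iffD1, rotated]) (simp add: \<tau>_def)
  have gS: "bij_betw \<tau> (A - S) (A - T)"
    using g by (rule bij_betw_cong[THEN iffD1, rotated]) (simp add: \<tau>_def)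
  have "bij_betw \<tau> (S \<union> (A - S)) (T \<union> (A - T))"
    by (rule bij_betw_combine[OF fS gS]) auto
  then have "\<tau> permutes A"
    using assms(2,3) by (intro bij_imp_permutes) (auto simp: \<tau>_def Un_absorb1)
  moreover have "\<tau> ` S = T"
    using fS by (simp add: bij_betw_def)
  ultimately show thesis ..
qed

lemma permutes_image_subset:
  assumes "\<sigma> permutes A" "S \<subseteq> A"
  shows "\<sigma> ` S \<subseteq> A" "card (\<sigma> ` S) = card S"
proof -
  show "\<sigma> ` S \<subseteq> A"
    using image_mono[OF assms(2), of \<sigma>] permutes_image[OF assms(1)] by simp
  show "card (\<sigma> ` S) = card S"
    by (rule card_image[OF inj_on_subset[OF permutes_inj[OF assms(1)]]]) simp
qed

text \<open>All sets of size \<open>card S\<close> are images of \<open>S\<close> equally often,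
  since composing with a permutation that carries one to the other is a bijection of the fibres. So
  |A|! is shared evenly by the \<open>card A choose card S\<close> subsets.\<close>

lemma card_permutes_image_eq:
  assumes A: "finite A" and S: "S \<subseteq> A" and T: "T \<subseteq> A" "card T = card S"
  shows "card {\<sigma>. \<sigma> permutes A \<and> \<sigma> ` S = T} = fact (card S) * fact (card A - card S)"
proof -
  let ?fib = "\<lambda>T. {\<sigma>. \<sigma> permutes A \<and> \<sigma> ` S = T}"
  let ?T = "{T. T \<subseteq> A \<and> card T = card S}"
  have eq: "card (?fib T') = card (?fib T)" if T': "T' \<in> ?T" for T'
  proof -
    obtain \<tau> where \<tau>: "\<tau> permutes A" "\<tau> ` T' = T"
      by (rule ex_permutes_image_eq[of A T' T]) (use A T T' in auto)
    have "bij_betw (\<lambda>\<sigma>. \<tau> \<circ> \<sigma>) (?fib T') (?fib T)"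
    proof (rule bij_betw_byWitness[where f' = "\<lambda>\<sigma>. inv \<tau> \<circ> \<sigma>"])
      have inv: "inv \<tau> permutes A" by (rule permutes_inv[OF \<tau>(1)])
      have invT: "inv \<tau> ` T = T'"
        using \<tau> by (metis image_inv_f_f permutes_inj)
      show "(\<lambda>\<sigma>. \<tau> \<circ> \<sigma>) ` ?fib T' \<subseteq> ?fib T"
        using \<tau> by (auto simp: permutes_compose image_comp[symmetric])
      show "(\<lambda>\<sigma>. inv \<tau> \<circ> \<sigma>) ` ?fib T \<subseteq> ?fib T'"
        using inv invT by (auto simp: permutes_compose image_comp[symmetric])
      show "\<forall>\<sigma>\<in>?fib T'. inv \<tau> \<circ> (\<tau> \<circ> \<sigma>) = \<sigma>" "\<forall>\<sigma>\<in>?fib T. \<tau> \<circ> (inv \<tau> \<circ> \<sigma>) = \<sigma>"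
        using permutes_inv_o[OF \<tau>(1)] by (simp_all flip: comp_assoc)
    qed
    then show ?thesis by (rule bij_betw_same_card)
  qed
  have "fact (card A) = card {\<sigma>. \<sigma> permutes A}"
    by (rule card_permutations[OF refl A, symmetric])
  also have "\<dots> = (\<Sum>T'\<in>?T. card {\<sigma>. \<sigma> \<in> {\<sigma>. \<sigma> permutes A} \<and> \<sigma> ` S = T'})"
  proof -
    have "finite {\<sigma>. \<sigma> permutes A}" "finite ?T"
      using A by (simp_all add: finite_permutations)
    moreover have "(\<lambda>\<sigma>. \<sigma> ` S) ` {\<sigma>. \<sigma> permutes A} \<subseteq> ?T"
      using permutes_image_subset[OF _ S] by auto
    ultimately show ?thesis
      using sum.group[of "{\<sigma>. \<sigma> permutes A}" ?T "\<lambda>\<sigma>. \<sigma> ` S" "\<lambda>_. 1 :: nat"] by simp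
  qed
  also have "\<dots> = (\<Sum>T'\<in>?T. card (?fib T))"
    by (rule sum.cong[OF refl]) (use eq in simp)
  also have "\<dots> = (card A choose card S) * card (?fib T)"
    by (simp add: n_subsets[OF A])
  finally have "fact (card A) = (card A choose card S) * card (?fib T)" .
  moreover have "fact (card S) * fact (card A - card S) * (card A choose card S) = fact (card A)"
    by (rule binomial_fact_lemma) (use A S in \<open>simp add: card_mono\<close>)
  moreover have "(card A choose card S) \<noteq> 0"
    using A S by (simp add: card_mono binomial_eq_0_iff not_less)
  ultimately show ?thesis
    by (metis (no_types) mult.commute mult_right_cancel)
qed

text \<open>Turns the average over permutations in \<open>symmetrize\<close> into a sum over
  subsets: for a product of two tensor powers only the set of positions sent to the first factor
  matters.\<close>

lemma sum_permutes_image: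
  fixes F :: "'a set \<Rightarrow> real"
  assumes A: "finite A" and S: "S \<subseteq> A"
  shows "(\<Sum>\<sigma> | \<sigma> permutes A. F (\<sigma> ` S))
    = fact (card S) * fact (card A - card S) * (\<Sum>T | T \<subseteq> A \<and> card T = card S. F T)"
proof -
  let ?T = "{T. T \<subseteq> A \<and> card T = card S}"
  have "(\<Sum>\<sigma> | \<sigma> permutes A. F (\<sigma> ` S))
      = (\<Sum>T\<in>?T. \<Sum>\<sigma> | \<sigma> \<in> {\<sigma>. \<sigma> permutes A} \<and> \<sigma> ` S = T. F (\<sigma> ` S))"
  proof (rule sum.group[symmetric])
    show "finite {\<sigma>. \<sigma> permutes A}" "finite ?T"
      using A by (simp_all add: finite_permutations)
    show "(\<lambda>\<sigma>. \<sigma> ` S) ` {\<sigma>. \<sigma> permutes A} \<subseteq> ?T"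
      using permutes_image_subset[OF _ S] by auto
  qed
  also have "\<dots> = (\<Sum>T\<in>?T. real (card {\<sigma>. \<sigma> permutes A \<and> \<sigma> ` S = T}) * F T)"
    by (intro sum.cong refl) simp
  also have "\<dots> = (\<Sum>T\<in>?T. (fact (card S) * fact (card A - card S)) * F T)"
    by (intro sum.cong refl) (use card_permutes_image_eq[OF A S] in auto)
  finally show ?thesis by (simp add: sum_distrib_left)
qed

lemma coord_prod_nth: "coord_prod h xs = (\<Prod>i<length xs. h $ (xs ! i))"
  by (simp add: coord_prod_def prod.list_conv_set_nth atLeast0LessThan)

lemma permute_list_eq_map: "permute_list \<sigma> xs = map (\<lambda>i. xs ! \<sigma> i) [0..<length xs]"
  by (simp add: permute_list_def)

lemma coord_prod_take_permute_list:
  assumes "\<sigma> permutes {..<length xs}" "j \<le> length xs"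
  shows "coord_prod y (take j (permute_list \<sigma> xs)) = (\<Prod>i\<in>\<sigma> ` {..<j}. y $ (xs ! i))"
proof -
  have "coord_prod y (take j (permute_list \<sigma> xs)) = (\<Prod>i<j. y $ (xs ! \<sigma> i))"
    using assms by (simp add: coord_prod_nth permute_list_eq_map)
  also have "\<dots> = (\<Prod>i\<in>\<sigma> ` {..<j}. y $ (xs ! i))"
    by (subst prod.reindex) (auto intro: inj_on_subset[OF permutes_inj[OF assms(1)]])
  finally show ?thesis .
qed

lemma coord_prod_drop_permute_list:
  assumes \<sigma>: "\<sigma> permutes {..<length xs}" and j: "j \<le> length xs"
  shows "coord_prod z (drop j (permute_list \<sigma> xs)) = (\<Prod>i\<in>{..<length xs} - \<sigma> ` {..<j}. z $ (xs ! i))"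
proof -
  have "coord_prod z (drop j (permute_list \<sigma> xs)) = (\<Prod>i<length xs - j. z $ (xs ! \<sigma> (j + i)))"
    using j by (auto simp: coord_prod_nth permute_list_eq_map less_diff_conv add.commute
        intro!: prod.cong)
  also have "\<dots> = (\<Prod>i\<in>{j..<length xs}. z $ (xs ! \<sigma> i))"
    by (rule prod.reindex_bij_witness[of _ "\<lambda>i. i - j" "\<lambda>i. j + i"]) (use j in auto)
  also have "\<dots> = (\<Prod>i\<in>\<sigma> ` {j..<length xs}. z $ (xs ! i))"
    by (subst prod.reindex) (auto intro: inj_on_subset[OF permutes_inj[OF \<sigma>]])
  also have "\<sigma> ` {j..<length xs} = {..<length xs} - \<sigma> ` {..<j}"
  proof -
    have "{j..<length xs} = {..<length xs} - {..<j}" by auto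
    then show ?thesis
      by (simp only: image_set_diff[OF permutes_inj[OF \<sigma>]] permutes_image[OF \<sigma>])
  qed
  finally show ?thesis .
qed

text \<open>The rule \<open>E y \<diamond> E z = E (y + z)\<close> on kernels. Multiplying out the
  product of y $ (xs ! i) + z $ (xs ! i) over the positions i gives one term for each set T of
  positions that take the factor from y; the summand j collects the sets of size j. The factorials
  in the two kernels cancel the number of permutations that yield the same T.\<close>

lemma sum_symmetrize_wick_exp_kernel:
  "(\<Sum>j\<le>m. symmetrize (tensor_prod j (wick_exp_kernel j y) (wick_exp_kernel (m - j) z)) xs)
    = wick_exp_kernel m (y + z) xs"
proof (cases "length xs = m")
  case False
  then show ?thesis
    by (auto simp: symmetrize_def tensor_prod_def wick_exp_kernel_def intro!: sum.neutral)
next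
  case True
  let ?A = "{..<m}"
  let ?F = "\<lambda>T. (\<Prod>i\<in>T. y $ (xs ! i)) * (\<Prod>i\<in>?A - T. z $ (xs ! i))"
  have "symmetrize (tensor_prod j (wick_exp_kernel j y) (wick_exp_kernel (m - j) z)) xs
      = (\<Sum>T | T \<subseteq> ?A \<and> card T = j. ?F T) / fact m" if j: "j \<le> m" for j
  proof -
    have "tensor_prod j (wick_exp_kernel j y) (wick_exp_kernel (m - j) z) (permute_list \<sigma> xs)
        = ?F (\<sigma> ` {..<j}) / (fact j * fact (m - j))" if "\<sigma> permutes ?A" for \<sigma>
      using that True j
      by (simp add: tensor_prod_def wick_exp_kernel_def coord_prod_take_permute_list
          coord_prod_drop_permute_list)
    then have "symmetrize (tensor_prod j (wick_exp_kernel j y) (wick_exp_kernel (m - j) z)) xs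
        = (\<Sum>\<sigma> | \<sigma> permutes ?A. ?F (\<sigma> ` {..<j})) / (fact j * fact (m - j)) / fact m"
      using True by (simp add: symmetrize_def sum_divide_distrib)
    also have "(\<Sum>\<sigma> | \<sigma> permutes ?A. ?F (\<sigma> ` {..<j}))
        = fact j * fact (m - j) * (\<Sum>T | T \<subseteq> ?A \<and> card T = j. ?F T)"
      using sum_permutes_image[of ?A "{..<j}" ?F] j by simp
    finally show ?thesis by simp
  qed
  then have "(\<Sum>j\<le>m. symmetrize (tensor_prod j (wick_exp_kernel j y) (wick_exp_kernel (m - j) z)) xs)
      = (\<Sum>j\<in>{..m}. \<Sum>T | T \<in> Pow ?A \<and> card T = j. ?F T) / fact m"
    by (simp add: sum_divide_distrib)
  also have "(\<Sum>j\<in>{..m}. \<Sum>T | T \<in> Pow ?A \<and> card T = j. ?F T) = (\<Sum>T\<in>Pow ?A. ?F T)"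
    by (rule sum.group) (auto simp: subset_eq_atLeast0_lessThan_card dest: card_mono[rotated])
  also have "\<dots> = (\<Prod>i<m. y $ (xs ! i) + z $ (xs ! i))"
    by (rule prod_add[symmetric]) simp
  finally show ?thesis
    using True by (simp add: wick_exp_kernel_def[of m "y + z" xs] coord_prod_nth)
qed

section \<open>Wick products of mixtures\<close>

lemma (in pair_sigma_finite) has_integral_pair_mult:
  fixes f g :: "_ \<Rightarrow> real"
  assumes f: "integrable M1 f" and g: "integrable M2 g"
  shows "has_bochner_integral (M1 \<Otimes>\<^sub>M M2) (\<lambda>x. f (fst x) * g (snd x)) (integral\<^sup>L M1 f * integral\<^sup>L M2 g)"
proof -
  note [measurable] = borel_measurable_integrable[OF f] borel_measurable_integrable[OF g]
  have i: "integrable (M1 \<Otimes>\<^sub>M M2) (\<lambda>x. f (fst x) * g (snd x))"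
  proof (rule Fubini_integrable)
    show "integrable M1 (\<lambda>x. LINT y|M2. norm (f (fst (x, y)) * g (snd (x, y))))"
      using f g by (simp add: abs_mult)
    show "AE x in M1. integrable M2 (\<lambda>y. f (fst (x, y)) * g (snd (x, y)))"
      using g by simp
  qed measurable
  have "integral\<^sup>L (M1 \<Otimes>\<^sub>M M2) (\<lambda>x. f (fst x) * g (snd x)) = integral\<^sup>L M1 f * integral\<^sup>L M2 g"
    using integral_fst'[OF i] by simp
  with i show ?thesis by (simp add: has_bochner_integral_iff)
qed

lemma tensor_inner_power2_le:
  "(tensor_inner m s t)\<^sup>2 \<le> tensor_inner m s s * tensor_inner m t t"
  using Cauchy_Schwarz_ineq_sum[of s t] by (simp add: tensor_inner_def power2_eq_square)

lemma abs_le_mean_if_power2_le: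
  fixes x s t :: real
  assumes "x\<^sup>2 \<le> s * t" "0 \<le> s" "0 \<le> t"
  shows "\<bar>x\<bar> \<le> (s + t) / 2"
proof (rule power2_le_imp_le)
  have "s * t \<le> ((s + t) / 2)\<^sup>2"
    using zero_le_power2[of "s - t"] by (simp add: power2_eq_square field_simps)
  with assms(1) show "\<bar>x\<bar>\<^sup>2 \<le> ((s + t) / 2)\<^sup>2" by simp
qed (use assms in simp)

section \<open>Growth of the S-transform of a test function\<close>

definition S_transform :: "(real ^ 'n \<Rightarrow> real) \<Rightarrow> real ^ 'n \<Rightarrow> real" where
  "S_transform \<phi> h = (LINT w|gauss. \<phi> w * wick_exp h w)"

lemma borel_measurable_S_transform:
  fixes \<phi> :: "real ^ 'n::finite \<Rightarrow> real"
  assumes [measurable]: "\<phi> \<in> borel_measurable borel"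
  shows "S_transform \<phi> \<in> borel_measurable borel"
proof -
  interpret gauss: prob_space "gauss :: (real ^ 'n) measure" by (rule prob_space_gauss)
  show ?thesis unfolding S_transform_def[abs_def] by measurable
qed

definition S_partial :: "'n::finite chaos_series \<Rightarrow> nat \<Rightarrow> real ^ 'n \<Rightarrow> real" where
  "S_partial u N h = (\<Sum>m<N. tensor_inner m (u m) (coord_prod h))"

lemma S_partial_tendsto:
  "has_chaos_expansion \<phi> u \<Longrightarrow> (\<lambda>N. S_partial u N h) \<longlonglongrightarrow> S_transform \<phi> h"
  using sums_tensor_inner_coord_prod[of \<phi> u h] by (simp add: sums_def S_partial_def S_transform_def)

text \<open>Cauchy-Schwarz in each order, with l^(2 m) m! moved to the side of \<open>u m\<close>
  and its inverse to the tensor power. The arithmetic mean then replaces the geometric one, so that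
  the two series can be summed separately: the first is the squared norm of \<open>u\<close> in
  \<open>G_lambda l\<close>, the second an exponential series. The growth rate improves with larger
  \<open>l\<close>.\<close>

lemma abs_S_partial_le:
  assumes u: "u \<in> G_lambda l" and l: "0 < l"
  shows "\<bar>S_partial u N h\<bar> \<le> ((\<Sum>m. fact m * l ^ (2 * m) * tensor_inner m (u m) (u m)) + exp ((norm h)\<^sup>2 / l\<^sup>2)) / 2"
proof -
  let ?s = "\<lambda>m. fact m * l ^ (2 * m) * tensor_inner m (u m) (u m)"
  let ?t = "\<lambda>m. ((norm h)\<^sup>2 / l\<^sup>2) ^ m / fact m"
  have s0: "0 \<le> ?s m" for m
    using l by (simp add: tensor_inner_self_nonneg)
  have "\<bar>tensor_inner m (u m) (coord_prod h)\<bar> \<le> (?s m + ?t m) / 2" for m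
  proof (rule abs_le_mean_if_power2_le)
    have "(tensor_inner m (u m) (coord_prod h))\<^sup>2 \<le> tensor_inner m (u m) (u m) * (norm h) ^ (2 * m)"
      using tensor_inner_power2_le[of m "u m" "coord_prod h"] sum_coord_prod_power2[of h m]
      by (simp add: tensor_inner_def power2_eq_square)
    also have "\<dots> = ?s m * ?t m"
      using l by (simp add: power_divide power_mult)
    finally show "(tensor_inner m (u m) (coord_prod h))\<^sup>2 \<le> ?s m * ?t m" .
  qed (use s0 in auto)
  then have "(\<Sum>m<N. \<bar>tensor_inner m (u m) (coord_prod h)\<bar>) \<le> (\<Sum>m<N. (?s m + ?t m) / 2)"
    by (rule sum_mono)
  then have "\<bar>S_partial u N h\<bar> \<le> (\<Sum>m<N. (?s m + ?t m) / 2)"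
    unfolding S_partial_def by (rule order_trans[OF sum_abs])
  also have "\<dots> = ((\<Sum>m<N. ?s m) + (\<Sum>m<N. ?t m)) / 2"
    by (simp add: sum.distrib flip: sum_divide_distrib)
  also have "(\<Sum>m<N. ?s m) \<le> (\<Sum>m. ?s m)"
    using u s0 by (intro sum_le_suminf) (auto simp: G_lambda_def)
  also have "(\<Sum>m<N. ?t m) \<le> exp ((norm h)\<^sup>2 / l\<^sup>2)"
    using exp_tail_bounds(1)[of "(norm h)\<^sup>2 / l\<^sup>2" N] by (simp add: exp_tail_def)
  finally show ?thesis by simp
qed

lemma abs_S_transform_le:
  assumes "has_chaos_expansion \<phi> u" "u \<in> G_lambda l" "0 < l"
  shows "\<bar>S_transform \<phi> h\<bar> \<le> ((\<Sum>m. fact m * l ^ (2 * m) * tensor_inner m (u m) (u m)) + exp ((norm h)\<^sup>2 / l\<^sup>2)) / 2"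
  by (rule LIMSEQ_le_const2[OF tendsto_rabs[OF S_partial_tendsto[OF assms(1)]]])
     (use abs_S_partial_le[OF assms(2,3)] in auto)

lemma power2_norm_add_le: "(norm (y + z))\<^sup>2 \<le> 2 * ((norm y)\<^sup>2 + (norm z)\<^sup>2)"
  for y z :: "'a::real_inner"
  using zero_le_power2[of "norm (y - z)"]
  by (simp add: power2_norm_eq_inner inner_simps inner_commute)

section \<open>Pairs of mixtures as integrals over the product of the two laws\<close>

locale weighted_pair = W1: weighted_prob \<nu>1 a + W2: weighted_prob \<nu>2 b
  for \<nu>1 :: "(real ^ 'n::finite) measure" and a and \<nu>2 :: "(real ^ 'n) measure" and b
begin

sublocale P: pair_prob_space \<nu>1 \<nu>2 ..

abbreviation P where "P \<equiv> \<nu>1 \<Otimes>\<^sub>M \<nu>2"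

definition weight :: "(real ^ 'n) \<times> (real ^ 'n) \<Rightarrow> real" where
  "weight x = a (fst x) * b (snd x)"

text \<open>The product of the two weights of \<open>weighted_prob\<close>. It dominates exp (|y +
  z|^2 / 4), which is both the squared norm of \<open>wick_exp (y + z)\<close> on the scale 1/2 and
  the growth of the S-transform on the scale 2.\<close>

definition envelope :: "(real ^ 'n) \<times> (real ^ 'n) \<Rightarrow> real" where
  "envelope x = exp ((norm (fst x))\<^sup>2 / 2) * exp ((norm (snd x))\<^sup>2 / 2)"

lemma borel_measurable_weight [measurable]: "weight \<in> borel_measurable (borel \<Otimes>\<^sub>M borel)"
  unfolding weight_def[abs_def] by measurable

lemma integrable_weight_envelope: "integrable P (\<lambda>x. \<bar>weight x\<bar> * envelope x)"
proof -
  have "integrable P (\<lambda>x. (\<bar>a (fst x)\<bar> * exp ((norm (fst x))\<^sup>2 / 2)) * (\<bar>b (snd x)\<bar> * exp ((norm (snd x))\<^sup>2 / 2)))"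
    using P.has_integral_pair_mult[OF W1.integrable_weight W2.integrable_weight]
    by (simp add: has_bochner_integral_iff)
  moreover have "(\<bar>a (fst x)\<bar> * exp ((norm (fst x))\<^sup>2 / 2)) * (\<bar>b (snd x)\<bar> * exp ((norm (snd x))\<^sup>2 / 2))
      = \<bar>weight x\<bar> * envelope x" for x
    by (simp add: weight_def envelope_def abs_mult mult_ac)
  ultimately show ?thesis by simp
qed

lemma envelope_ge: "1 \<le> envelope x" "exp ((norm (fst x + snd x))\<^sup>2 / 4) \<le> envelope x"
  using power2_norm_add_le[of "fst x" "snd x"] by (auto simp: envelope_def mult_exp_exp)

lemma integrable_abs_weight_mult:
  assumes [measurable]: "g \<in> borel_measurable (borel \<Otimes>\<^sub>M borel)"
    and le: "\<And>x. \<bar>g x\<bar> \<le> C * envelope x"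
  shows "integrable P (\<lambda>x. \<bar>weight x\<bar> * g x)"
proof (rule Bochner_Integration.integrable_bound)
  show "integrable P (\<lambda>x. C * (\<bar>weight x\<bar> * envelope x))"
    using integrable_weight_envelope by simp
  have "\<bar>\<bar>weight x\<bar> * g x\<bar> \<le> \<bar>C * (\<bar>weight x\<bar> * envelope x)\<bar>" for x
  proof -
    have "\<bar>\<bar>weight x\<bar> * g x\<bar> \<le> C * (\<bar>weight x\<bar> * envelope x)"
      using mult_left_mono[OF le[of x], of "\<bar>weight x\<bar>"] by (simp add: abs_mult mult.left_commute)
    then show ?thesis by (rule order_trans[OF _ abs_ge_self])
  qed
  then show "AE x in P. norm (\<bar>weight x\<bar> * g x) \<le> norm (C * (\<bar>weight x\<bar> * envelope x))"
    by simp
qed measurable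

lemma integrable_weight_mult:
  assumes [measurable]: "g \<in> borel_measurable (borel \<Otimes>\<^sub>M borel)"
    and le: "\<And>x. \<bar>g x\<bar> \<le> C * envelope x"
  shows "integrable P (\<lambda>x. weight x * g x)"
proof (rule Bochner_Integration.integrable_bound[OF integrable_abs_weight_mult[OF assms]])
  show "AE x in P. norm (weight x * g x) \<le> norm (\<bar>weight x\<bar> * g x)"
    by (simp add: abs_mult)
qed measurable

abbreviation wick_xi where "wick_xi \<equiv> wick W1.xi_weighted W2.xi_weighted"

text \<open>The Wick product of mixtures is the mixture of the Wick products: each entry of
  \<open>wick\<close> is a finite linear combination of products of two integrals, hence one
  integral over the product measure, and \<open>sum_symmetrize_wick_exp_kernel\<close> applies under
  it.\<close>

lemma has_integral_wick:
  "has_bochner_integral P (\<lambda>x. weight x * wick_exp_kernel m (fst x + snd x) xs) (wick_xi m xs)"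
proof -
  let ?S = "{\<sigma>. \<sigma> permutes {..<length xs}}"
  have "has_bochner_integral P
      (\<lambda>x. weight x * (wick_exp_kernel j (fst x) us * wick_exp_kernel k (snd x) vs))
      (W1.mean_kernel j us * W2.mean_kernel k vs)" for j k us vs
    using P.has_integral_pair_mult[OF W1.integrable_weight_wick_exp_kernel[of j us]
        W2.integrable_weight_wick_exp_kernel[of k vs]]
    by (simp add: weight_def W1.mean_kernel_def W2.mean_kernel_def mult_ac)
  then have "has_bochner_integral P
      (\<lambda>x. \<Sum>j\<le>m. (\<Sum>\<sigma>\<in>?S. weight x * (wick_exp_kernel j (fst x) (take j (permute_list \<sigma> xs)) *
          wick_exp_kernel (m - j) (snd x) (drop j (permute_list \<sigma> xs)))) / fact (length xs))
      (\<Sum>j\<le>m. (\<Sum>\<sigma>\<in>?S. W1.mean_kernel j (take j (permute_list \<sigma> xs)) *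
          W2.mean_kernel (m - j) (drop j (permute_list \<sigma> xs))) / fact (length xs))"
    by (intro has_bochner_integral_sum has_bochner_integral_divide_zero)
  moreover have "(\<Sum>j\<le>m. (\<Sum>\<sigma>\<in>?S. weight x * (wick_exp_kernel j (fst x) (take j (permute_list \<sigma> xs)) *
          wick_exp_kernel (m - j) (snd x) (drop j (permute_list \<sigma> xs)))) / fact (length xs))
      = weight x * wick_exp_kernel m (fst x + snd x) xs" for x
    unfolding sum_symmetrize_wick_exp_kernel[symmetric]
    by (simp add: symmetrize_def tensor_prod_def sum_distrib_left)
  ultimately show ?thesis
    by (simp add: wick_def W1.chaos_xi_weighted W2.chaos_xi_weighted symmetrize_def tensor_prod_def)
qed

lemma wick_eq: "wick_xi m xs = (LINT x|P. weight x * wick_exp_kernel m (fst x + snd x) xs)"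
  using has_bochner_integral_integral_eq[OF has_integral_wick] by simp

lemma wick_sym: "wick_xi m \<in> sym_tensors m"
proof (rule sym_tensorsI)
  show "wick_xi m xs = 0" if "length xs \<noteq> m" for xs
    unfolding wick_eq using sym_tensors_0[OF wick_exp_kernel_sym that] by simp
  show "wick_xi m (permute_list \<sigma> xs) = wick_xi m xs" if "\<sigma> permutes {..<length xs}" for \<sigma> xs
  proof -
    have "wick_exp_kernel m h (permute_list \<sigma> xs) = wick_exp_kernel m h xs" for h :: "real ^ 'n"
      using wick_exp_kernel_sym[of m h] that unfolding sym_tensors_def by blast
    then show ?thesis by (simp add: wick_eq)
  qed
qed

lemma sum_wick_exp_kernel_power2:
  "(\<Sum>xs | length xs = m. (wick_exp_kernel m h xs)\<^sup>2) = (norm h) ^ (2 * m) / (fact m)\<^sup>2"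
  for h :: "real ^ 'n"
  by (simp add: wick_exp_kernel_def power_divide sum_coord_prod_power2 flip: sum_divide_distrib)

lemma fact_mult_sum_wick_exp_kernel_power2:
  "fact m * (1 / 2) ^ (2 * m) * (\<Sum>xs | length xs = m. (wick_exp_kernel m h xs)\<^sup>2) = ((norm h)\<^sup>2 / 4) ^ m / fact m"
  for h :: "real ^ 'n"
  unfolding sum_wick_exp_kernel_power2
  by (simp add: power_mult power_divide power2_eq_square)

lemma integrable_abs_weight: "integrable P (\<lambda>x. \<bar>weight x\<bar>)"
  using integrable_abs_weight_mult[of "\<lambda>_. 1" 1] envelope_ge by simp

lemma power_div_fact_le_envelope: "((norm (fst x + snd x))\<^sup>2 / 4) ^ m / fact m \<le> envelope x"
  by (rule order_trans[OF power_div_fact_le_exp envelope_ge(2)]) simp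

lemma wick_exp_kernel_power2_le_envelope:
  "(wick_exp_kernel m (fst x + snd x) xs)\<^sup>2 \<le> 4 ^ m / fact m * envelope x"
proof (cases "length xs = m")
  case True
  let ?h = "fst x + snd x"
  have "fact m * (wick_exp_kernel m ?h xs)\<^sup>2 / 4 ^ m
      \<le> fact m * (\<Sum>xs | length xs = m. (wick_exp_kernel m ?h xs)\<^sup>2) / 4 ^ m"
    by (intro divide_right_mono mult_left_mono member_le_sum) (auto simp: True finite_lists_length)
  also have "\<dots> = ((norm ?h)\<^sup>2 / 4) ^ m / fact m"
    using fact_mult_sum_wick_exp_kernel_power2[of m ?h] by (simp add: power_mult power_divide)
  also have "\<dots> \<le> envelope x"
    by (rule power_div_fact_le_envelope)
  finally show ?thesis
    by (simp add: field_simps)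
next
  case False
  then show ?thesis
    using envelope_ge(1)[of x] by (simp add: wick_exp_kernel_def)
qed

lemma integrable_abs_weight_wick_exp_kernel_power2:
  "integrable P (\<lambda>x. \<bar>weight x\<bar> * (wick_exp_kernel m (fst x + snd x) xs)\<^sup>2)"
  by (rule integrable_abs_weight_mult[where C = "4 ^ m / fact m"])
     (use wick_exp_kernel_power2_le_envelope in auto)

lemma wick_power2_le:
  "(wick_xi m xs)\<^sup>2 \<le> (LINT x|P. \<bar>weight x\<bar>) * (LINT x|P. \<bar>weight x\<bar> * (wick_exp_kernel m (fst x + snd x) xs)\<^sup>2)"
proof -
  let ?f = "\<lambda>x. sqrt \<bar>weight x\<bar>"
  \<comment> \<open>The sign goes into the second factor only: the product then carries the signed
    weight while both squares carry its absolute value.\<close>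
  let ?g = "\<lambda>x. sqrt \<bar>weight x\<bar> * (sgn (weight x) * wick_exp_kernel m (fst x + snd x) xs)"
  have f: "(?f x)\<^sup>2 = \<bar>weight x\<bar>" for x
    by simp
  have g: "(?g x)\<^sup>2 = \<bar>weight x\<bar> * (wick_exp_kernel m (fst x + snd x) xs)\<^sup>2" for x
    by (simp add: power_mult_distrib power2_eq_square[of "sgn _"] sgn_if)
  have fg: "?f x * ?g x = weight x * wick_exp_kernel m (fst x + snd x) xs" for x
  proof -
    have "?f x * ?g x = (?f x * ?f x * sgn (weight x)) * wick_exp_kernel m (fst x + snd x) xs"
      by (simp only: mult_ac)
    then show ?thesis by (simp add: abs_mult_sgn)
  qed
  have "(LINT x|P. ?f x * ?g x)\<^sup>2 \<le> (LINT x|P. (?f x)\<^sup>2) * (LINT x|P. (?g x)\<^sup>2)"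
  proof (rule integral_mult_power2_le)
    show "integrable P (\<lambda>x. (?f x)\<^sup>2)" "integrable P (\<lambda>x. (?g x)\<^sup>2)"
      unfolding f g by (rule integrable_abs_weight integrable_abs_weight_wick_exp_kernel_power2)+
  qed measurable
  then show ?thesis unfolding f g fg wick_eq .
qed

text \<open>On the scale 1/2 the kernels of \<open>wick_exp h\<close> contribute (|h|^2 / 4)^m / m!,
  and their sum exp (|h|^2 / 4) at h = y + z stays below the integrable \<open>envelope\<close>.
  Cauchy-Schwarz passes this from the integrand to the integral.\<close>

theorem wick_G_star: "wick_xi \<in> G_star"
proof -
  let ?A = "LINT x|P. \<bar>weight x\<bar>"
  let ?c = "\<lambda>m. fact m * (1 / 2) ^ (2 * m) :: real"
  let ?h = "\<lambda>x. fst x + snd x :: real ^ 'n"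
  let ?t = "\<lambda>m x. ((norm (?h x))\<^sup>2 / 4) ^ m / fact m"
  have t: "integrable P (\<lambda>x. \<bar>weight x\<bar> * ?t m x)" for m
    by (rule integrable_abs_weight_mult[where C = 1]) (use power_div_fact_le_envelope in auto)
  have A0: "0 \<le> ?A" by simp
  have term_le: "?c m * tensor_inner m (wick_xi m) (wick_xi m) \<le> ?A * (LINT x|P. \<bar>weight x\<bar> * ?t m x)" for m
  proof -
    have "?c m * tensor_inner m (wick_xi m) (wick_xi m)
        \<le> ?c m * (\<Sum>xs | length xs = m. ?A * (LINT x|P. \<bar>weight x\<bar> * (wick_exp_kernel m (?h x) xs)\<^sup>2))"
      unfolding tensor_inner_def power2_eq_square[of "wick_xi _ _", symmetric]
      by (intro mult_left_mono sum_mono wick_power2_le) auto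
    also have "\<dots> = ?A * (LINT x|P. ?c m * (\<Sum>xs | length xs = m. \<bar>weight x\<bar> * (wick_exp_kernel m (?h x) xs)\<^sup>2))"
      by (subst integral_mult_right_zero, subst Bochner_Integration.integral_sum)
         (auto simp: integrable_abs_weight_wick_exp_kernel_power2 sum_distrib_left mult_ac)
    also have "(\<lambda>x. ?c m * (\<Sum>xs | length xs = m. \<bar>weight x\<bar> * (wick_exp_kernel m (?h x) xs)\<^sup>2))
        = (\<lambda>x. \<bar>weight x\<bar> * ?t m x)"
      unfolding fact_mult_sum_wick_exp_kernel_power2[symmetric] sum_distrib_left[symmetric] by (simp only: mult_ac)
    finally show ?thesis .
  qed
  have "(\<Sum>m<N. ?c m * tensor_inner m (wick_xi m) (wick_xi m))
      \<le> ?A * (LINT x|P. \<bar>weight x\<bar> * envelope x)" for N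
  proof -
    have "(\<Sum>m<N. ?c m * tensor_inner m (wick_xi m) (wick_xi m))
        \<le> (\<Sum>m<N. ?A * (LINT x|P. \<bar>weight x\<bar> * ?t m x))"
      by (rule sum_mono) (rule term_le)
    also have "\<dots> = ?A * (LINT x|P. (\<Sum>m<N. \<bar>weight x\<bar> * ?t m x))"
      by (subst Bochner_Integration.integral_sum[OF t]) (simp add: sum_distrib_left)
    also have "\<dots> \<le> ?A * (LINT x|P. \<bar>weight x\<bar> * envelope x)"
    proof (intro mult_left_mono[OF _ A0] integral_mono integrable_weight_envelope
        Bochner_Integration.integrable_sum t)
      fix x
      have "(\<Sum>m<N. ?t m x) \<le> envelope x"
        using exp_tail_bounds(1)[of "(norm (?h x))\<^sup>2 / 4" N] envelope_ge(2)[of x]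
        by (simp add: exp_tail_def)
      then show "(\<Sum>m<N. \<bar>weight x\<bar> * ?t m x) \<le> \<bar>weight x\<bar> * envelope x"
        unfolding sum_distrib_left[symmetric] by (rule mult_left_mono) simp
    qed
    finally show ?thesis .
  qed
  then have "summable (\<lambda>m. ?c m * tensor_inner m (wick_xi m) (wick_xi m))"
    by (intro summableI_nonneg_bounded) (auto simp: tensor_inner_self_nonneg)
  then have "wick_xi \<in> G_lambda (1 / 2)"
    using wick_sym by (simp add: G_lambda_def)
  then show ?thesis
    unfolding G_star_def by (intro UN_I[of "1 / 2"]) auto
qed

text \<open>The terms of the pairing are integrals of the terms of the S-transform at y + z, so the
  partial sums converge by dominated convergence. The scale 2 is dual to the scale 1/2 of
  \<open>wick_G_star\<close>, and it makes a multiple of \<open>envelope\<close> the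
  majorant.\<close>

theorem dual_pairing_wick:
  assumes \<phi>: "has_chaos_expansion \<phi> u" and u: "u \<in> G_lambda 2"
  shows "integrable P (\<lambda>x. weight x * S_transform \<phi> (fst x + snd x))"
    and "dual_pairing wick_xi \<phi> = (LINT x|P. weight x * S_transform \<phi> (fst x + snd x))"
proof -
  note [measurable] = has_chaos_expansionD(1)[OF \<phi>] borel_measurable_S_transform
  let ?h = "\<lambda>x. fst x + snd x :: real ^ 'n"
  define A where "A = (\<Sum>m. fact m * 2 ^ (2 * m) * tensor_inner m (u m) (u m))"
  have "0 \<le> A"
    unfolding A_def using u by (intro suminf_nonneg) (auto simp: G_lambda_def tensor_inner_self_nonneg)
  then have env: "(A + exp ((norm (?h x))\<^sup>2 / 4)) / 2 \<le> (A + 1) / 2 * envelope x" for x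
    using mult_left_mono[OF envelope_ge(1)[of x], of A] envelope_ge(2)[of x] by (simp add: field_simps)
  have bound: "\<bar>S_partial u N (?h x)\<bar> \<le> (A + 1) / 2 * envelope x"
    "\<bar>S_transform \<phi> (?h x)\<bar> \<le> (A + 1) / 2 * envelope x" for N x
    using abs_S_partial_le[OF u, of N "?h x"] abs_S_transform_le[OF \<phi> u, of "?h x"] env[of x]
    by (simp_all add: A_def)
  show "integrable P (\<lambda>x. weight x * S_transform \<phi> (?h x))"
    by (rule integrable_weight_mult[OF _ bound(2)]) measurable
  have term_eq: "has_bochner_integral P (\<lambda>x. weight x * tensor_inner m (u m) (coord_prod (?h x)))
      (fact m * tensor_inner m (wick_xi m) (u m))" for m
  proof -
    have "has_bochner_integral P
        (\<lambda>x. fact m * (\<Sum>xs | length xs = m. (weight x * wick_exp_kernel m (?h x) xs) * u m xs))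
        (fact m * (\<Sum>xs | length xs = m. wick_xi m xs * u m xs))"
      by (intro has_bochner_integral_mult_right has_bochner_integral_sum
          has_bochner_integral_mult_left has_integral_wick)
    moreover have "fact m * (\<Sum>xs | length xs = m. (weight x * wick_exp_kernel m (?h x) xs) * u m xs)
        = weight x * tensor_inner m (u m) (coord_prod (?h x))" for x
      by (simp add: wick_exp_kernel_def tensor_inner_def sum_distrib_left mult_ac)
    ultimately show ?thesis by (simp add: tensor_inner_def)
  qed
  have partial: "has_bochner_integral P (\<lambda>x. weight x * S_partial u N (?h x))
      (\<Sum>m<N. fact m * tensor_inner m (wick_xi m) (u m))" for N
    unfolding S_partial_def sum_distrib_left by (intro has_bochner_integral_sum term_eq)
  have "(\<lambda>N. LINT x|P. weight x * S_partial u N (?h x)) \<longlonglongrightarrow> (LINT x|P. weight x * S_transform \<phi> (?h x))"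
  proof (rule integral_dominated_convergence)
    show "integrable P (\<lambda>x. (A + 1) / 2 * (\<bar>weight x\<bar> * envelope x))"
      using integrable_weight_envelope by simp
    show "(\<lambda>x. weight x * S_partial u N (?h x)) \<in> borel_measurable P" for N
      using borel_measurable_integrable[OF integrable.intros[OF partial]] .
    show "AE x in P. (\<lambda>N. weight x * S_partial u N (?h x)) \<longlonglongrightarrow> weight x * S_transform \<phi> (?h x)"
      by (intro AE_I2 tendsto_intros S_partial_tendsto[OF \<phi>])
    show "AE x in P. norm (weight x * S_partial u N (?h x)) \<le> (A + 1) / 2 * (\<bar>weight x\<bar> * envelope x)" for N
    proof (rule AE_I2)
      fix x
      show "norm (weight x * S_partial u N (?h x)) \<le> (A + 1) / 2 * (\<bar>weight x\<bar> * envelope x)"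
        using mult_left_mono[OF bound(1)[of N x], of "\<bar>weight x\<bar>"]
        by (simp add: abs_mult mult.left_commute)
    qed
  qed measurable
  then have "(\<lambda>m. fact m * tensor_inner m (wick_xi m) (u m)) sums (LINT x|P. weight x * S_transform \<phi> (?h x))"
    by (simp add: sums_def has_bochner_integral_integral_eq[OF partial])
  then show "dual_pairing wick_xi \<phi> = (LINT x|P. weight x * S_transform \<phi> (?h x))"
    unfolding dual_pairing_def chaos_eqI[OF \<phi>] by (rule sums_unique[symmetric])
qed

end

section \<open>Exponential moments\<close>

text \<open>Jensen's inequality for the probability measure with density g / Z and the variable f Z
  / g. The free choice of \<open>g\<close> matters: with g = 1, Wick exponentials would cost the
  moment exp (p (p - 1) |y|^2 / 2) instead of exp ((p - 1) |y|^2 / 2).\<close>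

lemma integral_powr_le_weighted:
  fixes f g :: "'a \<Rightarrow> real"
  assumes p: "1 \<le> p" and fpos: "\<And>y. 0 < f y" and gpos: "\<And>y. 0 < g y"
    and f: "integrable M f" and g: "integrable M g" and g0: "0 < integral\<^sup>L M g"
    and fg: "integrable M (\<lambda>y. g y * (f y / g y) powr p)"
  shows "integral\<^sup>L M f powr p \<le> integral\<^sup>L M g powr (p - 1) * (LINT y|M. g y * (f y / g y) powr p)"
proof -
  define Z where "Z = integral\<^sup>L M g"
  have Z: "0 < Z" using g0 by (simp add: Z_def)
  note [measurable] = borel_measurable_integrable[OF f] borel_measurable_integrable[OF g]
  have nn: "AE y in M. 0 \<le> g y / Z"
    by (intro AE_I2 divide_nonneg_pos less_imp_le[OF gpos] Z)
  define N where "N = density M (\<lambda>y. g y / Z)"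
  have "emeasure N (space N) = (\<integral>\<^sup>+y. ennreal (g y / Z) \<partial>M)"
    unfolding N_def by (simp add: emeasure_density cong: nn_integral_cong)
  also have "\<dots> = ennreal (LINT y|M. g y / Z)"
    by (rule nn_integral_eq_integral) (use g nn in auto)
  also have "\<dots> = 1" using Z by (simp add: Z_def)
  finally interpret N: prob_space N by (rule prob_spaceI)
  have g_ne: "g y \<noteq> 0" for y using gpos[of y] by simp
  let ?X = "\<lambda>y. f y * Z / g y"
  have X1: "(g y / Z) *\<^sub>R ?X y = f y" for y
    using Z g_ne[of y] by simp
  have X2: "(g y / Z) *\<^sub>R (?X y powr p) = Z powr (p - 1) * (g y * (f y / g y) powr p)" for y
  proof -
    have "?X y powr p = (f y / g y) powr p * Z powr p"
      using fpos[of y] gpos[of y] Z by (simp add: powr_mult[symmetric])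
    moreover have "Z powr p = Z powr (p - 1) * Z"
      using Z by (simp add: powr_diff)
    ultimately show ?thesis using Z by simp
  qed
  have "N.expectation ?X powr p \<le> N.expectation (\<lambda>y. ?X y powr p)"
  proof (rule N.jensens_inequality[where I = "{0<..}" and a = 0])
    show "integrable N ?X"
      unfolding N_def by (subst integrable_density) (use f X1 nn in auto)
    show "integrable N (\<lambda>y. ?X y powr p)"
      unfolding N_def by (subst integrable_density) (use fg X2 nn in auto)
    show "AE y in N. ?X y \<in> {0<..}"
      using fpos gpos Z by simp
  qed (use p in \<open>auto intro: powr_convex\<close>)
  moreover have "N.expectation ?X = integral\<^sup>L M f"
    unfolding N_def by (subst integral_density) (use X1 nn in auto)
  moreover have "N.expectation (\<lambda>y. ?X y powr p) = Z powr (p - 1) * (LINT y|M. g y * (f y / g y) powr p)"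
    unfolding N_def by (subst integral_density) (use X2 nn in auto)
  ultimately show ?thesis by (simp add: Z_def)
qed

lemma abs_exp_diff_one_le: "\<bar>exp s - 1\<bar> \<le> \<bar>s\<bar> * exp \<bar>s\<bar>" for s :: real
proof (cases "0 \<le> s")
  case True
  have "1 - s \<le> exp (- s)" using exp_ge_add_one_self[of "- s"] by simp
  then have "(1 - s) * exp s \<le> exp (- s) * exp s" by (rule mult_right_mono) simp
  with True show ?thesis by (simp add: mult_exp_exp algebra_simps)
next
  case False
  then have "1 - exp s \<le> - s * 1"
    unfolding mult_1_right using exp_ge_add_one_self[of s] by linarith
  also have "\<dots> \<le> - s * exp (- s)" using False by (intro mult_left_mono) auto
  finally show ?thesis using False by simp
qed

lemma wick_exp_add: "wick_exp h (w + v) = wick_exp h w * exp (v \<bullet> h)"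
  by (simp add: wick_exp_def inner_simps exp_add[symmetric])

text \<open>Wick exponentials have Gaussian mean 1, so the factor in front is the p-th moment of
  \<open>wick_exp h\<close>.\<close>

lemma wick_exp_powr: "wick_exp h w powr p = exp ((p\<^sup>2 - p) / 2 * (norm h)\<^sup>2) * wick_exp (p *\<^sub>R h) w"
  by (simp add: wick_exp_def powr_def mult_exp_exp power_mult_distrib power2_eq_square algebra_simps
      flip: add_divide_distrib diff_divide_distrib)

locale gaussian_moment = prob_space \<nu> for \<nu> :: "(real ^ 'n::finite) measure" +
  fixes p :: real
  assumes sets_nu [measurable_cong]: "sets \<nu> = sets borel" and p: "2 < p"
    and moment: "integrable \<nu> (\<lambda>y. exp ((p - 1) * ((norm y)\<^sup>2 / 2)))"
begin

lemma integrable_if_le_moment: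
  assumes [measurable]: "g \<in> borel_measurable borel"
    and le: "\<And>y. \<bar>g y\<bar> \<le> C * exp ((p - 1) * ((norm y)\<^sup>2 / 2))"
  shows "integrable \<nu> g"
proof (rule Bochner_Integration.integrable_bound)
  show "integrable \<nu> (\<lambda>y. C * exp ((p - 1) * ((norm y)\<^sup>2 / 2)))"
    using moment by simp
  show "AE y in \<nu>. norm (g y) \<le> norm (C * exp ((p - 1) * ((norm y)\<^sup>2 / 2)))"
    using le by (auto intro: order_trans[OF _ abs_ge_self])
qed simp

sublocale W: weighted_prob \<nu> "\<lambda>_. 1"
proof unfold_locales
  show "integrable \<nu> (\<lambda>y. \<bar>1\<bar> * exp ((norm y)\<^sup>2 / 2))"
  proof (rule integrable_if_le_moment[where C = 1])
    have "1 * (norm y)\<^sup>2 \<le> (p - 1) * (norm y)\<^sup>2" for y :: "real ^ 'n"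
      using p by (intro mult_right_mono) auto
    then show "\<bar>\<bar>1\<bar> * exp ((norm y)\<^sup>2 / 2)\<bar> \<le> 1 * exp ((p - 1) * ((norm y)\<^sup>2 / 2))" for y :: "real ^ 'n"
      by simp
  qed simp
qed (simp_all add: sets_nu)

section \<open>Partial derivatives of \<open>xi\<close> as mixtures\<close>

lemma xi_eq: "xi \<nu> = W.xi_weighted"
  by (simp add: xi_def[abs_def] W.xi_weighted_def[abs_def] wick_exp_def)

text \<open>The surplus s = (p - 2) / 2 in the exponent pays for the coordinate: |y $ k| \<le> 1 +
  |y|^2, and t \<le> exp t at t = s |y|^2 produces the constant 1 / s.\<close>

lemma coord_weight_le:
  "\<bar>\<bar>y $ k\<bar> * exp ((norm y)\<^sup>2 / 2)\<bar> \<le> (1 + 2 / (p - 2)) * exp ((p - 1) * ((norm y)\<^sup>2 / 2))"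
proof -
  define s where "s = (p - 2) / 2"
  have s: "0 < s" using p by (simp add: s_def)
  have "\<bar>y $ k\<bar> \<le> norm y" by (rule component_le_norm_cart)
  also have "norm y \<le> 1 + (norm y)\<^sup>2"
  proof -
    have "2 * norm y \<le> (norm y)\<^sup>2 + 1"
      using zero_le_power2[of "norm y - 1"] by (simp add: power2_diff)
    then show ?thesis using norm_ge_zero[of y] by linarith
  qed
  also have "(norm y)\<^sup>2 = 1 / s * (s * (norm y)\<^sup>2)" using s by simp
  also have "1 + 1 / s * (s * (norm y)\<^sup>2) \<le> exp (s * (norm y)\<^sup>2) + 1 / s * exp (s * (norm y)\<^sup>2)"
  proof (intro add_mono mult_left_mono)
    show "s * (norm y)\<^sup>2 \<le> exp (s * (norm y)\<^sup>2)"
      using exp_ge_add_one_self[of "s * (norm y)\<^sup>2"] by linarith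
  qed (use s in auto)
  finally have "\<bar>y $ k\<bar> * exp ((norm y)\<^sup>2 / 2) \<le> ((1 + 1 / s) * exp (s * (norm y)\<^sup>2)) * exp ((norm y)\<^sup>2 / 2)"
    by (intro mult_right_mono) (auto simp: algebra_simps)
  also have "\<dots> = (1 + 1 / s) * exp (s * (norm y)\<^sup>2 + (norm y)\<^sup>2 / 2)"
    by (simp add: exp_add)
  also have "s * (norm y)\<^sup>2 + (norm y)\<^sup>2 / 2 = (p - 1) * ((norm y)\<^sup>2 / 2)"
    by (simp add: s_def field_simps)
  finally show ?thesis by (simp add: s_def)
qed

lemma weighted_prob_coord: "weighted_prob \<nu> (\<lambda>y. y $ k)"
proof unfold_locales
  show "integrable \<nu> (\<lambda>y. \<bar>y $ k\<bar> * exp ((norm y)\<^sup>2 / 2))"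
    by (rule integrable_if_le_moment[OF _ coord_weight_le]) simp
qed (simp_all add: sets_nu)

lemma partial_deriv_xi: "partial_deriv k (xi \<nu>) = weighted_prob.xi_weighted \<nu> (\<lambda>y. y $ k)"
proof
  fix w
  interpret C: weighted_prob \<nu> "\<lambda>y. y $ k" by (rule weighted_prob_coord)
  let ?e = "axis k 1 :: real ^ 'n"
  let ?f = "\<lambda>t. xi \<nu> (w + t *\<^sub>R ?e)"
  \<comment> \<open>Majorant of the difference quotients for |t| \<le> 1. With s = y $ k they are
    bounded by |s| exp |s| \<le> |s| (exp s + exp (-s)) times \<open>wick_exp y w\<close>, and
    multiplying \<open>wick_exp y w\<close> by exp (\<plusminus> s) shifts w by \<plusminus>
    \<open>?e\<close>. Thus \<open>?B\<close> consists of integrands of the coordinate mixture,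
    already known to be integrable.\<close>
  let ?B = "\<lambda>y. \<bar>y $ k * wick_exp y (w + ?e)\<bar> + \<bar>y $ k * wick_exp y (w - ?e)\<bar>"
  have quot: "(?f t - ?f 0) / t = (LINT y|\<nu>. wick_exp y w * ((exp (t * y $ k) - 1) / t))" for t
  proof -
    have "?f t - ?f 0 = (LINT y|\<nu>. wick_exp y (w + t *\<^sub>R ?e) - wick_exp y w)"
      using W.integrable_weight_wick_exp by (simp add: xi_eq W.xi_weighted_def)
    also have "\<dots> = (LINT y|\<nu>. wick_exp y w * (exp (t * y $ k) - 1))"
      by (intro Bochner_Integration.integral_cong refl)
         (simp add: wick_exp_add inner_axis' right_diff_distrib)
    finally show ?thesis by (simp flip: integral_divide_zero)
  qed
  have bound: "\<bar>wick_exp y w * ((exp (t * y $ k) - 1) / t)\<bar> \<le> ?B y" if t: "t \<noteq> 0" "\<bar>t\<bar> \<le> 1" for t y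
  proof -
    have "\<bar>exp (t * y $ k) - 1\<bar> \<le> \<bar>t * y $ k\<bar> * exp \<bar>t * y $ k\<bar>"
      by (rule abs_exp_diff_one_le)
    also have "\<dots> \<le> \<bar>t * y $ k\<bar> * exp \<bar>y $ k\<bar>"
      using t mult_right_mono[OF t(2), of "\<bar>y $ k\<bar>"] by (intro mult_left_mono) (auto simp: abs_mult)
    finally have "\<bar>(exp (t * y $ k) - 1) / t\<bar> \<le> \<bar>y $ k\<bar> * exp \<bar>y $ k\<bar>"
      using t by (simp add: abs_mult pos_divide_le_eq mult_ac)
    also have "\<dots> \<le> \<bar>y $ k\<bar> * (exp (y $ k) + exp (- y $ k))"
      by (intro mult_left_mono) (auto simp: abs_if)
    finally have "wick_exp y w * \<bar>(exp (t * y $ k) - 1) / t\<bar>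
        \<le> wick_exp y w * (\<bar>y $ k\<bar> * (exp (y $ k) + exp (- y $ k)))"
      by (rule mult_left_mono) (simp add: less_imp_le)
    also have "\<dots> = ?B y"
      using wick_exp_add[of y w ?e] wick_exp_add[of y w "- ?e"]
      by (simp add: abs_mult inner_axis' less_imp_le algebra_simps)
    finally show ?thesis
      by (simp add: abs_mult less_imp_le)
  qed
  have "(?f has_field_derivative C.xi_weighted w) (at 0)"
    unfolding DERIV_def tendsto_at_iff_sequentially
  proof (intro allI impI)
    fix X :: "nat \<Rightarrow> real" assume X: "\<forall>i. X i \<in> UNIV - {0}" "X \<longlonglongrightarrow> 0"
    \<comment> \<open>The majorant is valid only for |t| \<le> 1, so the sequence is followed from
      index \<open>N\<close> on; \<open>LIMSEQ_offset\<close> puts the beginning back.\<close>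
    from LIMSEQ_D[OF X(2), of 1] obtain N where N: "\<bar>X n\<bar> \<le> 1" if "N \<le> n" for n
      by (force intro: less_imp_le)
    have "(\<lambda>n. LINT y|\<nu>. wick_exp y w * ((exp (X (n + N) * y $ k) - 1) / X (n + N)))
        \<longlonglongrightarrow> (LINT y|\<nu>. y $ k * wick_exp y w)"
    proof (rule integral_dominated_convergence[where w = ?B])
      show "integrable \<nu> ?B"
        using C.integrable_weight_wick_exp by (intro Bochner_Integration.integrable_add integrable_abs)
      show "AE y in \<nu>. norm (wick_exp y w * ((exp (X (n + N) * y $ k) - 1) / X (n + N))) \<le> ?B y" for n
        using bound[of "X (n + N)"] N[of "n + N"] X(1) by auto
      show "AE y in \<nu>. (\<lambda>n. wick_exp y w * ((exp (X (n + N) * y $ k) - 1) / X (n + N)))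
          \<longlonglongrightarrow> y $ k * wick_exp y w"
      proof (rule AE_I2)
        fix y :: "real ^ 'n"
        have "((\<lambda>t. exp (t * y $ k)) has_field_derivative y $ k) (at 0)"
          by (auto intro!: derivative_eq_intros)
        then have "((\<lambda>t. (exp (t * y $ k) - 1) / t) \<longlongrightarrow> y $ k) (at 0)"
          by (simp add: DERIV_def)
        then have "(\<lambda>n. (exp (X n * y $ k) - 1) / X n) \<longlonglongrightarrow> y $ k"
          using X unfolding tendsto_at_iff_sequentially by (auto simp: o_def)
        then have "(\<lambda>n. wick_exp y w * ((exp (X (n + N) * y $ k) - 1) / X (n + N)))
            \<longlonglongrightarrow> wick_exp y w * y $ k"
          by (intro tendsto_intros LIMSEQ_ignore_initial_segment)
        then show "(\<lambda>n. wick_exp y w * ((exp (X (n + N) * y $ k) - 1) / X (n + N)))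
            \<longlonglongrightarrow> y $ k * wick_exp y w"
          by (simp add: mult.commute)
      qed
    qed measurable
    then have "(\<lambda>n. (?f (0 + X (n + N)) - ?f 0) / X (n + N)) \<longlonglongrightarrow> C.xi_weighted w"
      by (simp only: add_0 quot C.xi_weighted_def)
    then show "((\<lambda>h. (?f (0 + h) - ?f 0) / h) \<circ> X) \<longlonglongrightarrow> C.xi_weighted w"
      unfolding o_def by (rule LIMSEQ_offset)
  qed
  then show "partial_deriv k (xi \<nu>) w = C.xi_weighted w"
    unfolding partial_deriv_def by (rule DERIV_imp_deriv)
qed

section \<open>Higher integrability of \<open>xi\<close> and of the pointwise product\<close>

lemma xi_nonneg: "0 \<le> xi \<nu> w"
  by (simp add: xi_def)

lemma borel_measurable_xi [measurable]: "xi \<nu> \<in> borel_measurable borel"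
  unfolding xi_eq by (rule W.borel_measurable_xi_weighted)

text \<open>The weight \<open>exp ((p - 1) * |y|\<^sup>2 / 2)\<close> in Jensen's inequality is the one for which the
  Gaussian integral of the right-hand side is this weight again.\<close>

lemma integrable_xi_powr: "integrable gauss (\<lambda>w. xi \<nu> w powr p)"
proof -
  interpret gauss: prob_space "gauss :: (real ^ 'n) measure" by (rule prob_space_gauss)
  interpret Q: pair_sigma_finite \<nu> "gauss :: (real ^ 'n) measure" ..
  let ?g = "\<lambda>y :: real ^ 'n. exp ((p - 1) * ((norm y)\<^sup>2 / 2))"
  let ?Z = "integral\<^sup>L \<nu> ?g"
  let ?K = "\<lambda>w y. ?g y * wick_exp (p *\<^sub>R y) w"
  have K: "?g y * (wick_exp y w / ?g y) powr p = ?K w y" for w y :: "real ^ 'n"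
  proof -
    have "?g y * (wick_exp y w / ?g y) powr p = exp ((p - 1) * ((norm y)\<^sup>2 / 2) +
        ((p\<^sup>2 - p) / 2 * (norm y)\<^sup>2 - p * ((p - 1) * ((norm y)\<^sup>2 / 2)))) * wick_exp (p *\<^sub>R y) w"
      by (simp add: powr_divide less_imp_le wick_exp_powr exp_powr_real exp_add exp_diff mult.commute)
    also have "(p - 1) * ((norm y)\<^sup>2 / 2) +
        ((p\<^sup>2 - p) / 2 * (norm y)\<^sup>2 - p * ((p - 1) * ((norm y)\<^sup>2 / 2))) = (p - 1) * ((norm y)\<^sup>2 / 2)"
      by (simp add: power2_eq_square field_simps)
    finally show ?thesis .
  qed
  have int_K: "integrable \<nu> (\<lambda>y. ?K w y)" for w :: "real ^ 'n"
    by (rule integrable_if_le_moment[where C = "exp ((norm w)\<^sup>2 / 2)"])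
       (auto simp: abs_mult less_imp_le mult.commute intro!: mult_left_mono wick_exp_le)
  have "(LINT y|\<nu>. 1) \<le> ?Z"
    by (rule integral_mono) (use moment p in auto)
  then have Z: "0 < ?Z" by (simp add: prob_space)
  have le: "xi \<nu> w powr p \<le> ?Z powr (p - 1) * (LINT y|\<nu>. ?K w y)" for w
  proof -
    have "integrable \<nu> (\<lambda>y. wick_exp y w)"
      using W.integrable_weight_wick_exp by simp
    then have "(LINT y|\<nu>. wick_exp y w) powr p
        \<le> ?Z powr (p - 1) * (LINT y|\<nu>. ?g y * (wick_exp y w / ?g y) powr p)"
      by (intro integral_powr_le_weighted) (use p moment Z in \<open>auto simp only: K int_K wick_exp_pos exp_gt_zero\<close>)
    then show ?thesis
      unfolding K by (simp add: xi_eq W.xi_weighted_def)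
  qed
  have "integrable (\<nu> \<Otimes>\<^sub>M gauss) (\<lambda>(y, w). ?K w y)"
  proof (rule Q.Fubini_integrable)
    show "integrable \<nu> (\<lambda>y. LINT w|gauss. norm (case (y, w) of (y, w) \<Rightarrow> ?K w y))"
      using moment
      by (simp add: abs_mult less_imp_le has_bochner_integral_integral_eq[OF has_integral_wick_exp])
    show "AE y in \<nu>. integrable gauss (\<lambda>w. case (y, w) of (y, w) \<Rightarrow> ?K w y)"
      by (simp add: integrable.intros[OF has_integral_wick_exp])
  qed measurable
  from Q.integrable_snd[OF this] have "integrable gauss (\<lambda>w. LINT y|\<nu>. ?K w y)" .
  then have "integrable gauss (\<lambda>w. ?Z powr (p - 1) * (LINT y|\<nu>. ?K w y))"
    by simp
  then show ?thesis
    by (rule Bochner_Integration.integrable_bound) (use le in \<open>auto intro: order_trans[OF _ abs_ge_self]\<close>)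
qed

end

text \<open>Each factor has an integrable p-th power, and 2 r s \<le> r^2 + s^2 applied to the
  powers p / 2 leaves half the exponent for the product; this still exceeds 1 because 2 < p.\<close>

lemma xi_mult_Lspace:
  assumes "gaussian_moment \<nu>1 p" "gaussian_moment \<nu>2 p"
  shows "(\<lambda>w. xi \<nu>1 w * xi \<nu>2 w) \<in> Lspace (p / 2)"
proof -
  interpret M1: gaussian_moment \<nu>1 p by fact
  interpret M2: gaussian_moment \<nu>2 p by fact
  have le: "\<bar>xi \<nu>1 w * xi \<nu>2 w\<bar> powr (p / 2) \<le> xi \<nu>1 w powr p + xi \<nu>2 w powr p" for w
  proof -
    have sq: "(r powr (p / 2))\<^sup>2 = r powr p" for r
      by (simp add: power2_eq_square flip: powr_add)
    have "2 * xi \<nu>1 w powr (p / 2) * xi \<nu>2 w powr (p / 2) \<le> xi \<nu>1 w powr p + xi \<nu>2 w powr p"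
      using sum_squares_bound[of "xi \<nu>1 w powr (p / 2)" "xi \<nu>2 w powr (p / 2)"] by (simp add: sq)
    moreover have "0 \<le> xi \<nu>1 w powr (p / 2) * xi \<nu>2 w powr (p / 2)"
      by simp
    moreover have "\<bar>xi \<nu>1 w * xi \<nu>2 w\<bar> powr (p / 2) = xi \<nu>1 w powr (p / 2) * xi \<nu>2 w powr (p / 2)"
      by (simp add: M1.xi_nonneg M2.xi_nonneg powr_mult abs_mult)
    ultimately show ?thesis by linarith
  qed
  have "integrable gauss (\<lambda>w. \<bar>xi \<nu>1 w * xi \<nu>2 w\<bar> powr (p / 2))"
    by (rule Bochner_Integration.integrable_bound[OF
          Bochner_Integration.integrable_add[OF M1.integrable_xi_powr M2.integrable_xi_powr]])
       (use le in auto)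
  then show ?thesis by (simp add: Lspace_def)
qed

section \<open>The inequality\<close>

text \<open>The budget of the pointwise product. The inner product takes at most 1/2 of each squared
  norm out of the available (p - 1) / 2, and |y + z|^2 / l^2 takes at most 2 / l^2, so
  \<open>l\<close> only has to make 2 / l^2 \<le> (p - 2) / 2.\<close>

lemma ex_dilation:
  fixes p :: real
  assumes "2 < p"
  obtains l :: real where "1 \<le> l"
    and "\<And>y z :: 'a::real_inner. y \<bullet> z + (norm (y + z))\<^sup>2 / l\<^sup>2
      \<le> (p - 1) * ((norm y)\<^sup>2 / 2) + (p - 1) * ((norm z)\<^sup>2 / 2)"
proof
  \<comment> \<open>The required inequality is l^2 \<ge> 4 / (p - 2); the summand 1 ensures l \<ge>
    1 and thereby l^2 \<ge> l.\<close>
  define l where "l = 1 + 4 / (p - 2)"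
  have d: "0 \<le> 4 / (p - 2)" using assms by simp
  show l: "1 \<le> l" using d by (simp add: l_def)
  have "4 / (p - 2) \<le> l" by (simp add: l_def)
  also have "l * 1 \<le> l\<^sup>2" unfolding power2_eq_square using l by (intro mult_left_mono) auto
  finally have l2: "2 / l\<^sup>2 \<le> (p - 2) / 2"
    using assms l by (simp add: field_simps)
  fix y z :: 'a
  let ?r = "(norm y)\<^sup>2 + (norm z)\<^sup>2"
  have "y \<bullet> z \<le> ?r / 2"
    using zero_le_power2[of "norm (y - z)"] by (simp add: power2_norm_eq_inner inner_simps inner_commute)
  moreover have "(norm (y + z))\<^sup>2 / l\<^sup>2 \<le> (2 * ?r) / l\<^sup>2"
    by (intro divide_right_mono power2_norm_add_le) simp
  moreover have "(2 * ?r) / l\<^sup>2 \<le> (p - 2) / 2 * ?r"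
    using mult_right_mono[OF l2, of ?r] by simp
  ultimately have "y \<bullet> z + (norm (y + z))\<^sup>2 / l\<^sup>2 \<le> ?r / 2 + (p - 2) / 2 * ?r"
    by linarith
  also have "\<dots> = (p - 1) * ((norm y)\<^sup>2 / 2) + (p - 1) * ((norm z)\<^sup>2 / 2)"
    by (simp add: field_simps)
  finally show "y \<bullet> z + (norm (y + z))\<^sup>2 / l\<^sup>2
      \<le> (p - 1) * ((norm y)\<^sup>2 / 2) + (p - 1) * ((norm z)\<^sup>2 / 2)" .
qed

text \<open>The test function being nonnegative, Tonelli's theorem reduces integrability to the growth of
  its S-transform.  This replaces the embedding of the test functions into all \<open>Lspace r\<close>.\<close>

lemma fun_pairing_xi_xi:
  fixes \<nu>1 \<nu>2 :: "(real ^ 'n::finite) measure"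
  assumes "gaussian_moment \<nu>1 p" "gaussian_moment \<nu>2 p"
    and \<phi>: "has_chaos_expansion \<phi> u" and u: "\<And>l. 1 \<le> l \<Longrightarrow> u \<in> G_lambda l"
    and nonneg: "AE w in gauss. 0 \<le> \<phi> w"
  shows "has_bochner_integral (\<nu>1 \<Otimes>\<^sub>M \<nu>2) (\<lambda>x. exp (fst x \<bullet> snd x) * S_transform \<phi> (fst x + snd x))
    (fun_pairing (\<lambda>w. xi \<nu>1 w * xi \<nu>2 w) \<phi>)"
proof -
  interpret M1: gaussian_moment \<nu>1 p by fact
  interpret M2: gaussian_moment \<nu>2 p by fact
  interpret weighted_pair \<nu>1 "\<lambda>_. 1" \<nu>2 "\<lambda>_. 1" ..
  interpret gauss: prob_space "gauss :: (real ^ 'n) measure" by (rule prob_space_gauss)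
  interpret Q: pair_sigma_finite P "gauss :: (real ^ 'n) measure" ..
  note [measurable] = has_chaos_expansionD(1)[OF \<phi>] borel_measurable_S_transform
  let ?h = "\<lambda>x. fst x + snd x :: real ^ 'n"
  let ?F = "\<lambda>x w. wick_exp (fst x) w * wick_exp (snd x) w * \<phi> w"
  let ?G = "\<lambda>x. exp (fst x \<bullet> snd x) * S_transform \<phi> (?h x)"
  let ?g = "\<lambda>y :: real ^ 'n. exp ((p - 1) * ((norm y)\<^sup>2 / 2))"
  obtain l where l: "1 \<le> l" and dil: "\<And>y z :: real ^ 'n. y \<bullet> z + (norm (y + z))\<^sup>2 / l\<^sup>2
      \<le> (p - 1) * ((norm y)\<^sup>2 / 2) + (p - 1) * ((norm z)\<^sup>2 / 2)"
    using ex_dilation[OF M1.p] by blast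
  define A where "A = (\<Sum>m. fact m * l ^ (2 * m) * tensor_inner m (u m) (u m))"
  have A: "0 \<le> A"
    unfolding A_def using u[OF l] l
    by (intro suminf_nonneg) (auto simp: G_lambda_def tensor_inner_self_nonneg)
  have intG: "integrable P ?G"
  proof (rule Bochner_Integration.integrable_bound)
    show "integrable P (\<lambda>x. (A + 1) / 2 * (?g (fst x) * ?g (snd x)))"
      using integrable.intros[OF P.has_integral_pair_mult[OF M1.moment M2.moment]] by simp
    show "?G \<in> borel_measurable P" by measurable
    show "AE x in P. norm (?G x) \<le> norm ((A + 1) / 2 * (?g (fst x) * ?g (snd x)))"
    proof (rule AE_I2)
      fix x :: "(real ^ 'n) \<times> (real ^ 'n)"
      have "\<bar>S_transform \<phi> (?h x)\<bar> \<le> (A + exp ((norm (?h x))\<^sup>2 / l\<^sup>2)) / 2"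
        unfolding A_def by (rule abs_S_transform_le[OF \<phi> u[OF l]]) (use l in simp)
      also have "\<dots> \<le> (A + 1) / 2 * exp ((norm (?h x))\<^sup>2 / l\<^sup>2)"
        using mult_left_mono[OF _ A, of 1 "exp ((norm (?h x))\<^sup>2 / l\<^sup>2)"] by (simp add: field_simps)
      finally have "\<bar>?G x\<bar> \<le> exp (fst x \<bullet> snd x) * ((A + 1) / 2 * exp ((norm (?h x))\<^sup>2 / l\<^sup>2))"
        by (simp add: abs_mult)
      also have "\<dots> = (A + 1) / 2 * exp (fst x \<bullet> snd x + (norm (?h x))\<^sup>2 / l\<^sup>2)"
        by (simp add: exp_add)
      also have "\<dots> \<le> (A + 1) / 2 * exp ((p - 1) * ((norm (fst x))\<^sup>2 / 2) + (p - 1) * ((norm (snd x))\<^sup>2 / 2))"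
        using A dil[of "fst x" "snd x"] by (intro mult_left_mono) auto
      also have "\<dots> = (A + 1) / 2 * (?g (fst x) * ?g (snd x))"
        by (simp add: exp_add)
      finally show "norm (?G x) \<le> norm ((A + 1) / 2 * (?g (fst x) * ?g (snd x)))"
        unfolding real_norm_def by (rule order_trans[OF _ abs_ge_self])
    qed
  qed
  have F_eq: "?F x w = exp (fst x \<bullet> snd x) * (\<phi> w * wick_exp (?h x) w)" for x w
    using wick_exp_mult[of "fst x" w "snd x"] by simp
  have intF: "integrable gauss (?F x)" "(LINT w|gauss. ?F x w) = ?G x" for x
    unfolding F_eq using integrable_mult_wick_exp[OF has_chaos_expansionD(1,2)[OF \<phi>], of "?h x"]
    by (simp_all add: S_transform_def)
  have absF: "(LINT w|gauss. norm (?F x w)) = ?G x" for x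
    unfolding intF(2)[symmetric]
    by (rule integral_cong_AE) (use nonneg in \<open>auto simp: abs_mult less_imp_le\<close>)
  have int: "integrable (P \<Otimes>\<^sub>M gauss) (\<lambda>(x, w). ?F x w)"
  proof (rule Q.Fubini_integrable)
    show "integrable P (\<lambda>x. LINT w|gauss. norm (case (x, w) of (x, w) \<Rightarrow> ?F x w))"
      unfolding prod.case absF by (rule intG)
    show "AE x in P. integrable gauss (\<lambda>w. case (x, w) of (x, w) \<Rightarrow> ?F x w)"
      unfolding prod.case by (rule AE_I2) (rule intF(1))
  qed measurable
  have "(LINT x|P. ?F x w) = xi \<nu>1 w * xi \<nu>2 w * \<phi> w" for w
    using has_bochner_integral_integral_eq[OF P.has_integral_pair_mult[of "\<lambda>y. wick_exp y w" "\<lambda>z. wick_exp z w"]]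
      M1.W.integrable_weight_wick_exp[of w] M2.W.integrable_weight_wick_exp[of w]
    by (simp add: M1.xi_eq M2.xi_eq M1.W.xi_weighted_def M2.W.xi_weighted_def)
  then have "fun_pairing (\<lambda>w. xi \<nu>1 w * xi \<nu>2 w) \<phi> = (LINT w|gauss. LINT x|P. ?F x w)"
    by (simp only: fun_pairing_def)
  also have "\<dots> = (LINT x|P. LINT w|gauss. ?F x w)"
    by (rule Q.Fubini_integral[OF int])
  finally show ?thesis
    using intG by (simp add: intF(2) has_bochner_integral_iff)
qed

lemma S_transform_nonneg:
  assumes "AE w in gauss. 0 \<le> \<phi> w"
  shows "0 \<le> S_transform \<phi> h"
  unfolding S_transform_def
  by (rule integral_nonneg_AE) (use assms in \<open>auto simp: less_imp_le\<close>)

theorem proposition3p11: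
  fixes \<nu>1 \<nu>2 :: "(real ^ 'n) measure" and p :: real
  assumes "prob_space \<nu>1" and "sets \<nu>1 = sets borel"
    and "prob_space \<nu>2" and "sets \<nu>2 = sets borel"
    and "p > 2"
    and "integrable \<nu>1 (\<lambda>y. exp ((p - 1) * ((norm y)\<^sup>2 / 2)))"
    and "integrable \<nu>2 (\<lambda>y. exp ((p - 1) * ((norm y)\<^sup>2 / 2)))"
  shows "(\<exists>q>1. (\<lambda>w. xi \<nu>1 w * xi \<nu>2 w) \<in> Lspace q) \<and>
    wick (xi \<nu>1) (xi \<nu>2) \<in> G_star \<and>
    (\<forall>k. wick (partial_deriv k (xi \<nu>1)) (partial_deriv k (xi \<nu>2)) \<in> G_star) \<and>
    (\<forall>\<phi>\<in>G_space. (AE w in gauss. 0 \<le> \<phi> w) \<longrightarrow>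
      fun_pairing (\<lambda>w. xi \<nu>1 w * xi \<nu>2 w) \<phi>
        - dual_pairing (wick (xi \<nu>1) (xi \<nu>2)) \<phi>
        - (\<Sum>k\<in>UNIV. dual_pairing (wick (partial_deriv k (xi \<nu>1)) (partial_deriv k (xi \<nu>2))) \<phi>)
      \<ge> 0)"
proof -
  have gm: "gaussian_moment \<nu>1 p" "gaussian_moment \<nu>2 p"
    using assms by (auto intro!: gaussian_moment.intro gaussian_moment_axioms.intro)
  interpret M1: gaussian_moment \<nu>1 p by (rule gm)
  interpret M2: gaussian_moment \<nu>2 p by (rule gm)
  interpret W: weighted_pair \<nu>1 "\<lambda>_. 1" \<nu>2 "\<lambda>_. 1" ..
  have coord: "weighted_pair \<nu>1 (\<lambda>y. y $ k) \<nu>2 (\<lambda>y. y $ k)" for k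
    by (intro weighted_pair.intro M1.weighted_prob_coord M2.weighted_prob_coord)
  have xi_eq: "wick (xi \<nu>1) (xi \<nu>2) = W.wick_xi"
    by (simp add: M1.xi_eq M2.xi_eq)
  show ?thesis
  proof (intro conjI allI ballI impI)
    show "\<exists>q>1. (\<lambda>w. xi \<nu>1 w * xi \<nu>2 w) \<in> Lspace q"
      using xi_mult_Lspace[OF gm] assms(5) by (intro exI[of _ "p / 2"]) simp
    show "wick (xi \<nu>1) (xi \<nu>2) \<in> G_star"
      unfolding xi_eq by (rule W.wick_G_star)
    show "wick (partial_deriv k (xi \<nu>1)) (partial_deriv k (xi \<nu>2)) \<in> G_star" for k
      unfolding M1.partial_deriv_xi M2.partial_deriv_xi by (rule weighted_pair.wick_G_star[OF coord])
    fix \<phi> :: "real ^ 'n \<Rightarrow> real"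
    assume "\<phi> \<in> G_space" and nonneg: "AE w in gauss. 0 \<le> \<phi> w"
    then obtain u where \<phi>: "has_chaos_expansion \<phi> u" and u: "\<And>l. 1 \<le> l \<Longrightarrow> u \<in> G_lambda l"
      by (auto simp: G_space_def)
    \<comment> \<open>Enough for the Wick pairings; for the pointwise product the whole family
      \<open>u\<close> is passed on, as its scale comes from \<open>ex_dilation\<close> and depends
      on \<open>p\<close>.\<close>
    have u2: "u \<in> G_lambda 2" by (rule u) simp
    let ?S = "\<lambda>x. S_transform \<phi> (fst x + snd x)"
    have 1: "has_bochner_integral (\<nu>1 \<Otimes>\<^sub>M \<nu>2) (\<lambda>x. exp (fst x \<bullet> snd x) * ?S x)
        (fun_pairing (\<lambda>w. xi \<nu>1 w * xi \<nu>2 w) \<phi>)"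
      by (rule fun_pairing_xi_xi[OF gm \<phi> u nonneg])
    have 2: "has_bochner_integral (\<nu>1 \<Otimes>\<^sub>M \<nu>2) ?S (dual_pairing (wick (xi \<nu>1) (xi \<nu>2)) \<phi>)"
      using W.dual_pairing_wick[OF \<phi> u2] by (simp add: xi_eq has_bochner_integral_iff W.weight_def)
    have 3: "has_bochner_integral (\<nu>1 \<Otimes>\<^sub>M \<nu>2) (\<lambda>x. (fst x $ k * snd x $ k) * ?S x)
        (dual_pairing (wick (partial_deriv k (xi \<nu>1)) (partial_deriv k (xi \<nu>2))) \<phi>)" for k
      using weighted_pair.dual_pairing_wick[OF coord \<phi> u2, of k]
      by (simp add: M1.partial_deriv_xi M2.partial_deriv_xi has_bochner_integral_iff
          weighted_pair.weight_def[OF coord])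
    have "has_bochner_integral (\<nu>1 \<Otimes>\<^sub>M \<nu>2)
        (\<lambda>x. exp (fst x \<bullet> snd x) * ?S x - ?S x - (\<Sum>k\<in>UNIV. (fst x $ k * snd x $ k) * ?S x))
        (fun_pairing (\<lambda>w. xi \<nu>1 w * xi \<nu>2 w) \<phi> - dual_pairing (wick (xi \<nu>1) (xi \<nu>2)) \<phi>
          - (\<Sum>k\<in>UNIV. dual_pairing (wick (partial_deriv k (xi \<nu>1)) (partial_deriv k (xi \<nu>2))) \<phi>))"
      by (intro has_bochner_integral_diff has_bochner_integral_sum 1 2 3)
    moreover have "exp (fst x \<bullet> snd x) * ?S x - ?S x - (\<Sum>k\<in>UNIV. (fst x $ k * snd x $ k) * ?S x)
        = (exp (fst x \<bullet> snd x) - 1 - fst x \<bullet> snd x) * ?S x" for x :: "(real ^ 'n) \<times> (real ^ 'n)"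
      by (simp add: inner_vec_def sum_distrib_right left_diff_distrib)
    moreover have "0 \<le> (exp (fst x \<bullet> snd x) - 1 - fst x \<bullet> snd x) * ?S x" for x
    proof (rule mult_nonneg_nonneg[OF _ S_transform_nonneg[OF nonneg]])
      show "0 \<le> exp (fst x \<bullet> snd x) - 1 - fst x \<bullet> snd x"
        using exp_ge_add_one_self[of "fst x \<bullet> snd x"] by linarith
    qed
    ultimately show "0 \<le> fun_pairing (\<lambda>w. xi \<nu>1 w * xi \<nu>2 w) \<phi> - dual_pairing (wick (xi \<nu>1) (xi \<nu>2)) \<phi>
          - (\<Sum>k\<in>UNIV. dual_pairing (wick (partial_deriv k (xi \<nu>1)) (partial_deriv k (xi \<nu>2))) \<phi>)"
      by (metis (no_types, lifting) has_bochner_integral_integral_eq Bochner_Integration.integral_nonneg)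
  qed
qed

end
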